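(* Let $C_m$ be the cycle with $m\ge3$ edges. Then \[ \mathrm{vol}(\mathscr{P}(C_m))=\mathrm{vol}(\mathscr{Q}(C_m))-\frac{2^{m-1}}{2(2m)!}=\frac{m\,A_{2m-1}}{2^m(2m)!}-\frac{2^{m-2}}{(2m)!}, \] volumes being taken in $\mathbb{R}^{2m}$.
   Context: $C_m$ has vertices $1,\dots,m$ and edges $(1,2),\dots,(m-1,m),(m,1)$. Polytopes live in $\mathbb{R}^{2m}$ with coordinates $x_i$ (vertices) and $y_{ij}$ (edges). $\mathscr{Q}(C_m)$: points with all coordinates in $[0,1]$ satisfying for each edge $(i,j)$: $y_{ij}\ge0$, $y_{ij}\le x_i$, $y_{ij}\le x_j$, $x_i+x_j\le1+y_{ij}$. $\mathscr{P}(C_m)$ (boolean quadric polytope) is the convex hull of all $0/1$ points satisfying $x_ix_j=y_{ij}$ for every edge $(i,j)$. The Euler number $A_k$ ($k\ge1$) is the number of permutations $w$ of $\{1,\dots,k\}$ with $w_1>w_2<w_3>\cdots$; $A_0:=1$. *)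

theory Defs
  imports "HOL-Analysis.Analysis" "HOL-Combinatorics.Permutations"
begin

text \<open>
  A finite graph is given by a map \<open>ends :: 'e \<Rightarrow> 'v \<times> 'v\<close> from its edges to their end points; the
  order of the two end points plays no role below. The index type \<open>'v + 'e\<close> provides one coordinate
  for each vertex (\<open>x\<^sub>i = p $ Inl i\<close>) and one for each edge (\<open>y\<^sub>e = p $ Inr e\<close>).

  A graph is the cycle \<open>C\<^sub>m\<close> if its vertices and edges can be labelled bijectively by \<open>1, \<dots>, m\<close> such
  that the edges are \<open>(1,2), \<dots>, (m-1,m), (m,1)\<close>. Thus \<open>'v\<close> and \<open>'e\<close> both have \<open>m\<close> elements and
  \<open>real ^ ('v + 'e)\<close> is the Euclidean space of dimension \<open>2 m\<close>.
\<close>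

definition is_cycle :: "nat \<Rightarrow> ('e \<Rightarrow> 'v \<times> 'v) \<Rightarrow> bool" where
  "is_cycle m ends \<longleftrightarrow>
     (\<exists>v e. bij_betw v {1..m} UNIV \<and> bij_betw e {1..m} UNIV \<and>
        (\<forall>i\<in>{1..m}. ends (e i) = (v i, v (if i = m then 1 else i + 1))))"

definition Q_polytope :: "('e::finite \<Rightarrow> 'v::finite \<times> 'v) \<Rightarrow> (real ^ ('v + 'e)) set" where
  "Q_polytope ends =
     {p. (\<forall>k. 0 \<le> p $ k \<and> p $ k \<le> 1) \<and>
         (\<forall>e i j. ends e = (i, j) \<longrightarrow>
            p $ Inr e \<ge> 0 \<and> p $ Inr e \<le> p $ Inl i \<and> p $ Inr e \<le> p $ Inl j \<and>
            p $ Inl i + p $ Inl j \<le> 1 + p $ Inr e)}"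

definition P_polytope :: "('e::finite \<Rightarrow> 'v::finite \<times> 'v) \<Rightarrow> (real ^ ('v + 'e)) set" where
  "P_polytope ends = convex hull
     {p. (\<forall>k. p $ k = 0 \<or> p $ k = 1) \<and>
         (\<forall>e i j. ends e = (i, j) \<longrightarrow> p $ Inl i * p $ Inl j = p $ Inr e)}"

definition euler_number :: "nat \<Rightarrow> nat" where
  "euler_number k =
     card {w. w permutes {1..k} \<and>
              (\<forall>i\<in>{1..<k}. if odd i then w i > w (i + 1) else w i < w (i + 1))}"

text \<open>The usual convention for \<open>k = 0\<close> is a consequence of the definition.\<close>

lemma euler_number_0 [simp]: "euler_number 0 = 1"
  by (simp add: euler_number_def)

end

theory Submission
  imports Defs
begin

text \<open>
  Put \<open>d\<^sub>k = x\<^sub>k + x\<^sub>k\<^sub>+\<^sub>1 - 2 y\<^sub>k\<close>, which is \<open>\<bar>x\<^sub>k - x\<^sub>k\<^sub>+\<^sub>1\<bar>\<close> at the vertices of \<open>P\<close>. Replacing \<open>x\<^sub>i\<close> by \<open>1 - x\<^sub>i\<close> for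
  all \<open>i\<close> in a set \<open>R\<close>, and each \<open>y\<^sub>k\<close> by the corresponding probability (``switching'' at \<open>R\<close>),
  is an affine volume-preserving symmetry of \<open>P\<close> and \<open>Q\<close> that turns \<open>d\<^sub>k\<close> into \<open>1 - d\<^sub>k\<close> at the
  edges leaving \<open>R\<close>.

  \<open>P\<close> is cut out of \<open>Q\<close> by the \<open>2\<^sup>m\<^sup>-\<^sup>1\<close> cycle inequalities, all switchings of
  \<open>d\<^sub>m\<^sub>-\<^sub>1 \<le> d\<^sub>0 + \<dots> + d\<^sub>m\<^sub>-\<^sub>2\<close>. For sufficiency, a point is realised as the edge marginals of random
  bits by extending a coupling along the path vertex by vertex, each time prescribing also the joint
  law with vertex \<open>0\<close>. The pieces cut off are pairwise disjoint, and each is a simplex which a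
  linear map of determinant \<open>\<plusminus>2\<close> takes to the standard simplex.

  Up to null sets, \<open>Q\<close> consists of \<open>2\<^sup>m\<close> switched copies of its part in \<open>x < 1/2\<close>, which is half of the
  order polytope of the zigzag poset on a cycle of length \<open>2 m\<close>. The maximal label of a linear extension sits at
  one of the \<open>m\<close> vertices; cutting the cycle there leaves an alternating permutation of \<open>2 m - 1\<close> letters.
\<close>

section \<open>Volumes under triangular maps\<close>

text \<open>Fubini with the coordinate \<open>b\<close> innermost: since \<open>g\<close> ignores
  this coordinate, the map acts on each line in direction \<open>b\<close> as
  \<open>y \<mapsto> c * y + const\<close>, and the one-dimensional affine substitution produces the
  factor.\<close>

lemma nn_integral_coordinate_update:
  fixes f :: "'a::euclidean_space \<Rightarrow> ennreal" and g :: "'a \<Rightarrow> real" and c :: real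
  assumes b: "b \<in> Basis" and c: "c \<noteq> 0"
    and f [measurable]: "f \<in> borel_measurable borel"
    and g [measurable]: "g \<in> borel_measurable borel"
    and indep: "\<And>x t. g (x + t *\<^sub>R b) = g x"
  shows "(\<integral>\<^sup>+x. f x \<partial>lborel)
           = ennreal \<bar>c\<bar> * (\<integral>\<^sup>+x. f (x + ((c - 1) * (x \<bullet> b) + g x) *\<^sub>R b) \<partial>lborel)"
proof -
  define B where "B = Basis - {b}"
  have B: "Basis = insert b B" "b \<notin> B" "finite B"
    using b by (auto simp: B_def)
  interpret product_sigma_finite "\<lambda>_::'a. lborel :: real measure" by standard
  let ?e = "\<lambda>x :: 'a \<Rightarrow> real. \<Sum>a\<in>Basis. x a *\<^sub>R a"
  let ?T = "\<lambda>x. x + ((c - 1) * (x \<bullet> b) + g x) *\<^sub>R b"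
  have e_meas [measurable]: "?e \<in> (\<Pi>\<^sub>M a\<in>insert b B. lborel) \<rightarrow>\<^sub>M borel"
    by (simp add: B(1)[symmetric])
  have split: "(\<integral>\<^sup>+x. h x \<partial>lborel) = (\<integral>\<^sup>+x. \<integral>\<^sup>+y. h (?e (x(b := y))) \<partial>lborel \<partial>(\<Pi>\<^sub>M a\<in>B. lborel))"
    if h [measurable]: "h \<in> borel_measurable borel" for h :: "'a \<Rightarrow> ennreal"
  proof -
    have "(\<integral>\<^sup>+x. h x \<partial>lborel) = (\<integral>\<^sup>+x. h (?e x) \<partial>(\<Pi>\<^sub>M a\<in>insert b B. lborel))"
      by (subst lborel_eq, subst nn_integral_distr) (auto simp: B(1)[symmetric])
    also have "\<dots> = (\<integral>\<^sup>+x. \<integral>\<^sup>+y. h (?e (x(b := y))) \<partial>lborel \<partial>(\<Pi>\<^sub>M a\<in>B. lborel))"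
      by (rule product_nn_integral_insert) (use B in auto)
    finally show ?thesis .
  qed
  have e_upd: "?e (x(b := y)) = ?e (x(b := 0)) + y *\<^sub>R b" for x y
  proof -
    have "(\<Sum>a\<in>B. (x(b := y)) a *\<^sub>R a) = (\<Sum>a\<in>B. (x(b := 0)) a *\<^sub>R a)"
      using B(2) by (intro sum.cong) auto
    then show ?thesis
      using B(2,3) unfolding B(1) by simp
  qed
  have e_b: "?e (x(b := y)) \<bullet> b = y" for x y
    using b by (subst inner_sum_left_Basis) auto
  have T_e: "?T (?e (x(b := y))) = ?e (x(b := g (?e (x(b := 0))) + c * y))" for x y
  proof -
    have "g (?e (x(b := y))) = g (?e (x(b := 0)))"
      using indep[of "?e (x(b := 0))" y] by (simp only: e_upd[of x y])
    then have "?T (?e (x(b := y))) = ?e (x(b := 0)) + y *\<^sub>R b + ((c - 1) * y + g (?e (x(b := 0)))) *\<^sub>R b"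
      by (simp only: e_b) (simp only: e_upd[of x y])
    also have "\<dots> = ?e (x(b := 0)) + (g (?e (x(b := 0))) + c * y) *\<^sub>R b"
      by (simp add: algebra_simps)
    finally show ?thesis
      by (simp only: e_upd[of x "g (?e (x(b := 0))) + c * y"])
  qed
  have slice [measurable]: "(\<lambda>y. ?e (x(b := y))) \<in> borel_measurable borel" for x
  proof -
    have "(\<lambda>y. ?e (x(b := y))) = (\<lambda>y. ?e (x(b := 0)) + y *\<^sub>R b)"
      by (rule ext) (rule e_upd)
    then show ?thesis
      by (simp only:) measurable
  qed
  have "(\<integral>\<^sup>+x. f x \<partial>lborel) = (\<integral>\<^sup>+x. \<integral>\<^sup>+y. f (?e (x(b := y))) \<partial>lborel \<partial>(\<Pi>\<^sub>M a\<in>B. lborel))"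
    by (rule split) simp
  also have "\<dots> = (\<integral>\<^sup>+x. ennreal \<bar>c\<bar> * (\<integral>\<^sup>+y. f (?T (?e (x(b := y)))) \<partial>lborel) \<partial>(\<Pi>\<^sub>M a\<in>B. lborel))"
    unfolding T_e
    by (intro nn_integral_cong nn_integral_real_affine) (use c in measurable)
  also have "\<dots> = ennreal \<bar>c\<bar> * (\<integral>\<^sup>+x. \<integral>\<^sup>+y. f (?T (?e (x(b := y)))) \<partial>lborel \<partial>(\<Pi>\<^sub>M a\<in>B. lborel))"
  proof (rule nn_integral_cmult)
    have [measurable]: "(\<lambda>p. ?e ((fst p)(b := snd p))) \<in> ((\<Pi>\<^sub>M a\<in>B. lborel) \<Otimes>\<^sub>M lborel) \<rightarrow>\<^sub>M borel"
    proof -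
      have "(\<lambda>p. (fst p)(b := snd p)) \<in> ((\<Pi>\<^sub>M a\<in>B. lborel) \<Otimes>\<^sub>M (lborel :: real measure)) \<rightarrow>\<^sub>M (\<Pi>\<^sub>M a\<in>insert b B. lborel)"
        by (rule measurable_fun_upd[where J = B]) auto
      then show ?thesis
        by (rule measurable_compose[OF _ e_meas])
    qed
    have "(\<lambda>(x, y). f (?T (?e (x(b := y))))) \<in> borel_measurable ((\<Pi>\<^sub>M a\<in>B. lborel) \<Otimes>\<^sub>M lborel)"
      unfolding case_prod_beta by measurable
    then show "(\<lambda>x. \<integral>\<^sup>+y. f (?T (?e (x(b := y)))) \<partial>lborel) \<in> borel_measurable (\<Pi>\<^sub>M a\<in>B. lborel)"
      by (rule lborel.borel_measurable_nn_integral)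
  qed
  also have "(\<integral>\<^sup>+x. \<integral>\<^sup>+y. f (?T (?e (x(b := y)))) \<partial>lborel \<partial>(\<Pi>\<^sub>M a\<in>B. lborel)) = (\<integral>\<^sup>+x. f (?T x) \<partial>lborel)"
    by (rule split[symmetric]) measurable
  finally show ?thesis .
qed

lemma measurable_vec_lambda_borel:
  fixes f :: "'n::finite \<Rightarrow> 'a \<Rightarrow> real"
  assumes "\<And>i. f i \<in> borel_measurable M"
  shows "(\<lambda>x. \<chi> i. f i x) \<in> M \<rightarrow>\<^sub>M borel"
  by (subst borel_measurable_euclidean_space)
     (use assms in \<open>auto simp: Basis_vec_def inner_axis\<close>)

lemma measurable_vec_nth_borel [measurable]:
  "(\<lambda>x :: real ^ 'n::finite. x $ i) \<in> borel_measurable borel"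
  by (intro borel_measurable_continuous_onI continuous_intros)

text \<open>The matrix of \<open>f\<close> is triangular in the order given by the rank
  \<open>r\<close>, with diagonal \<open>c\<close>, although \<open>g\<close> may be nonlinear.
  Hence \<open>f\<close> is a composition of updates of single coordinates, each contributing its
  factor \<open>\<bar>c i\<bar>\<close>.\<close>

lemma emeasure_triangular_vimage:
  fixes f :: "real ^ 'n \<Rightarrow> real ^ 'n" and r :: "'n::finite \<Rightarrow> nat"
  assumes f: "\<And>p i. f p $ i = c i * p $ i + g i p"
    and c: "\<And>i. c i \<noteq> 0"
    and g [measurable]: "\<And>i. g i \<in> borel_measurable borel"
    and dep: "\<And>i p q. (\<And>j. r j < r i \<Longrightarrow> p $ j = q $ j) \<Longrightarrow> g i p = g i q"
    and S: "S \<in> sets borel"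
  shows "f -` S \<in> sets borel"
    and "emeasure lborel S = ennreal (\<Prod>i\<in>UNIV. \<bar>c i\<bar>) * emeasure lborel (f -` S)"
proof -
  \<comment> \<open>\<open>F A\<close> updates only the coordinates in \<open>A\<close>. The
    induction adds coordinates in order of decreasing rank: everything already in \<open>A\<close>
    has rank at least \<open>r i\<close>, so \<open>g i\<close> still sees the original values and
    one more update \<open>?U\<close> turns \<open>F A\<close> into
    \<open>F (insert i A)\<close>.\<close>
  define F where "F A p = (\<chi> i. if i \<in> A then f p $ i else p $ i)" for A p
  have F_meas [measurable]: "F A \<in> borel_measurable borel" for A
    unfolding F_def f by (rule measurable_vec_lambda_borel) measurable
  have main: "\<forall>S\<in>sets borel. emeasure lborel S = ennreal (\<Prod>i\<in>A. \<bar>c i\<bar>) * emeasure lborel (F A -` S)" for A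
    using finite[of A]
  proof (induction A rule: finite_ranking_induct[where f = "\<lambda>i. - int (r i)"])
    case empty
    have "F {} = (\<lambda>p. p)" by (simp add: F_def fun_eq_iff)
    then show ?case by simp
  next
    case (insert i A)
    show ?case
    proof (cases "i \<in> A")
      case True
      then show ?thesis using insert by (simp add: insert_absorb)
    next
      case False
      let ?U = "\<lambda>x. x + ((c i - 1) * (x \<bullet> axis i 1) + g i x) *\<^sub>R axis i 1"
      have F_insert: "F (insert i A) p = ?U (F A p)" for p
      proof -
        have "g i (F A p) = g i p"
          by (rule dep) (use insert(2) in \<open>force simp: F_def\<close>)
        then show ?thesis
          using False unfolding cart_eq_inner_axis[symmetric]
          by (auto simp: vec_eq_iff F_def f axis_def algebra_simps)
      qed
      show ?thesis
      proof
        fix S :: "(real ^ 'n) set"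
        assume S [measurable]: "S \<in> sets borel"
        have US [measurable]: "?U -` S \<in> sets borel"
          using measurable_sets[of ?U borel borel S] by simp
        have "emeasure lborel S = (\<integral>\<^sup>+x. indicator S x \<partial>lborel)"
          by simp
        also have "\<dots> = ennreal \<bar>c i\<bar> * (\<integral>\<^sup>+x. indicator S (?U x) \<partial>lborel)"
        proof (rule nn_integral_coordinate_update)
          show "axis i 1 \<in> (Basis :: (real ^ 'n) set)"
            by (auto simp: Basis_vec_def)
          show "g i (x + t *\<^sub>R axis i 1) = g i x" for x t
            by (rule dep) (auto simp: axis_def)
        qed (use c in measurable)
        also have "(\<integral>\<^sup>+x. indicator S (?U x) \<partial>lborel) = (\<integral>\<^sup>+x. indicator (?U -` S) x \<partial>lborel)"
          by (simp add: indicator_def)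
        also have "\<dots> = emeasure lborel (?U -` S)"
          by (rule nn_integral_indicator) (simp add: US)
        also have "\<dots> = ennreal (\<Prod>i\<in>A. \<bar>c i\<bar>) * emeasure lborel (F A -` (?U -` S))"
          using insert(3) US by blast
        also have "F A -` (?U -` S) = F (insert i A) -` S"
          by (simp add: F_insert vimage_def)
        finally show "emeasure lborel S = ennreal (\<Prod>i\<in>insert i A. \<bar>c i\<bar>) * emeasure lborel (F (insert i A) -` S)"
          using False by (simp add: ennreal_mult' prod_nonneg mult.assoc)
      qed
    qed
  qed
  have "F UNIV = f"
    by (simp add: F_def fun_eq_iff)
  then show "emeasure lborel S = ennreal (\<Prod>i\<in>UNIV. \<bar>c i\<bar>) * emeasure lborel (f -` S)"
    using main[of UNIV] S by simp
  show "f -` S \<in> sets borel"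
    using measurable_sets[OF F_meas[of UNIV] S] \<open>F UNIV = f\<close> by simp
qed

corollary measure_triangular_vimage:
  fixes f :: "real ^ 'n \<Rightarrow> real ^ 'n" and r :: "'n::finite \<Rightarrow> nat"
  assumes "\<And>p i. f p $ i = c i * p $ i + g i p"
    and "\<And>i. c i \<noteq> 0"
    and "\<And>i. g i \<in> borel_measurable borel"
    and "\<And>i p q. (\<And>j. r j < r i \<Longrightarrow> p $ j = q $ j) \<Longrightarrow> g i p = g i q"
    and "S \<in> sets borel"
  shows "measure lborel (f -` S) = measure lborel S / (\<Prod>i\<in>UNIV. \<bar>c i\<bar>)"
proof -
  have D: "(\<Prod>i\<in>UNIV. \<bar>c i\<bar>) > 0"
    using assms(2) by (simp add: prod_pos)
  have "measure lborel S = (\<Prod>i\<in>UNIV. \<bar>c i\<bar>) * measure lborel (f -` S)"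
    using emeasure_triangular_vimage(2)[OF assms, where r = r] D
    by (simp only: measure_def enn2real_mult) simp
  with D show ?thesis
    by (simp only: field_simps)
qed

lemma measure_scale_vimage:
  fixes S :: "(real ^ 'n::finite) set"
  assumes "S \<in> sets borel" "a \<noteq> 0"
  shows "(\<lambda>p. a *\<^sub>R p) -` S \<in> sets borel"
    and "measure lborel ((\<lambda>p. a *\<^sub>R p) -` S) = measure lborel S / \<bar>a\<bar> ^ CARD('n)"
  using emeasure_triangular_vimage(1)[of "\<lambda>p. a *\<^sub>R p" "\<lambda>_. a" "\<lambda>_ _. 0" "\<lambda>_. 0" S]
    measure_triangular_vimage[of "\<lambda>p. a *\<^sub>R p" "\<lambda>_. a" "\<lambda>_ _. 0" "\<lambda>_. 0" S] assms
  by simp_all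

text \<open>Both sets lie between the closed simplex and its interior, which differ by the null
  frontier of a convex set. The open version serves linear extensions, the half-open one serves the
  pieces cut off from \<open>Q\<close>.\<close>

lemma measure_std_simplex:
  "measure lborel {w :: real ^ 'n::finite. (\<forall>i. 0 < w $ i) \<and> (\<Sum>i\<in>UNIV. w $ i) < 1} = 1 / fact CARD('n)"
    (is "measure lborel ?I = _")
  "measure lborel {w :: real ^ 'n. (\<forall>i. 0 \<le> w $ i) \<and> (\<Sum>i\<in>UNIV. w $ i) < 1} = 1 / fact CARD('n)"
    (is "measure lborel ?A = _")
proof -
  let ?S = "convex hull (insert 0 Basis) :: (real ^ 'n) set"
  have Basis: "(Basis :: (real ^ 'n) set) = (\<lambda>i. axis i 1) ` UNIV"
    by (auto simp: Basis_vec_def)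
  have inj: "inj (\<lambda>i :: 'n. axis i (1 :: real))"
    by (simp add: inj_on_def axis_eq_axis)
  have S: "?S = {w. (\<forall>i. 0 \<le> w $ i) \<and> (\<Sum>i\<in>UNIV. w $ i) \<le> 1}"
    unfolding std_simplex unfolding Basis by (simp add: sum.reindex[OF inj] inner_axis)
  have I: "interior ?S = ?I"
    unfolding interior_std_simplex unfolding Basis by (simp add: sum.reindex[OF inj] inner_axis)
  have [measurable]: "?I \<in> sets borel" "?A \<in> sets borel"
    by measurable
  have compact: "compact ?S"
    by (rule finite_imp_compact_convex_hull) simp
  then have S_borel [measurable]: "?S \<in> sets borel"
    by (simp add: compact_imp_closed)
  have "measure lebesgue (interior ?S) = measure lebesgue ?S"
    using compact by (intro measure_interior negligible_convex_frontier)
      (auto simp: compact_imp_bounded)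
  then have eq: "measure lborel ?I = measure lborel ?S"
    by (simp add: I measure_completion)
  have cont: "measure lborel ?S = 1 / fact CARD('n)"
    using content_std_simplex[where 'a = "real ^ 'n"] by simp
  have fin: "emeasure lborel ?S \<noteq> \<infinity>"
    using emeasure_bounded_finite[of ?S] compact by (simp add: compact_imp_bounded less_top)
  have fmS: "?S \<in> fmeasurable lborel"
    using fin by (simp add: fmeasurable_def less_top)
  have fmA: "?A \<in> fmeasurable lborel"
    by (rule fmeasurableI2[OF fmS]) (auto simp: S)
  show "measure lborel ?I = 1 / fact CARD('n)"
    using eq cont by simp
  moreover have "measure lborel ?I \<le> measure lborel ?A"
    by (rule measure_mono_fmeasurable) (auto intro: less_imp_le fmA)
  moreover have "measure lborel ?A \<le> measure lborel ?S"
    by (rule measure_mono_fmeasurable) (auto simp: S fmS[unfolded S])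
  ultimately show "measure lborel ?A = 1 / fact CARD('n)"
    using cont by linarith
qed

section \<open>Coupling random bits along a path\<close>

text \<open>These are the Frechet bounds: exactly the values \<open>c\<close> that can be the
  probability of two bits being both one when the single bits are one with probabilities
  \<open>a\<close> and \<open>b\<close>.\<close>

definition edge_constraints :: "real \<Rightarrow> real \<Rightarrow> real \<Rightarrow> bool" where
  "edge_constraints a b c \<longleftrightarrow> 0 \<le> c \<and> c \<le> a \<and> c \<le> b \<and> a + b \<le> 1 + c"

text \<open>The least value of a sum over \<open>i < k\<close> of terms \<open>d\<^sub>i\<close> or \<open>1 - d\<^sub>i\<close>, the latter being chosen an odd
  number of times iff \<open>b\<close>. No such sum exists for \<open>k = 0\<close> and odd parity; only values below \<open>1\<close> matter,
  so \<open>1\<close> serves as infinity.\<close>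

fun flip_cost :: "(nat \<Rightarrow> real) \<Rightarrow> nat \<Rightarrow> bool \<Rightarrow> real" where
  "flip_cost d 0 b = of_bool b"
| "flip_cost d (Suc k) b = min (flip_cost d k b + d k) (flip_cost d k (\<not> b) + 1 - d k)"

lemma flip_cost_nonneg:
  assumes "\<And>i. i < k \<Longrightarrow> 0 \<le> d i \<and> d i \<le> 1"
  shows "0 \<le> flip_cost d k b"
  using assms
proof (induction k arbitrary: b)
  case (Suc k)
  then have "0 \<le> flip_cost d k b" "0 \<le> flip_cost d k (\<not> b)" "0 \<le> d k" "d k \<le> 1"
    by auto
  then show ?case by simp
qed simp

text \<open>Two choices of opposite parity differ at some index, where the terms \<open>d i\<close>
  and \<open>1 - d i\<close> already add up to 1. For \<open>k = 0\<close> the value chosen as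
  infinity is just large enough.\<close>

lemma flip_cost_sum_ge_1:
  assumes "\<And>i. i < k \<Longrightarrow> 0 \<le> d i \<and> d i \<le> 1"
  shows "1 \<le> flip_cost d k False + flip_cost d k True"
  using assms
proof (induction k)
  case (Suc k)
  have "0 \<le> flip_cost d k False" "0 \<le> flip_cost d k True"
    using Suc.prems by (auto intro!: flip_cost_nonneg)
  moreover have "0 \<le> d k" "d k \<le> 1" "1 \<le> flip_cost d k False + flip_cost d k True"
    using Suc by auto
  ultimately show ?case by (auto simp: min_def)
qed simp

text \<open>A triangle inequality along the path: passing from \<open>x k\<close> to
  \<open>x (Suc k)\<close> costs at least \<open>\<bar>x k - x (Suc k)\<bar>\<close> for the term
  \<open>d k\<close>, and at least \<open>\<bar>1 - x k - x (Suc k)\<bar>\<close> for the term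
  \<open>1 - d k\<close>, which replaces a bit by its complement.\<close>

lemma flip_cost_ge_dist:
  assumes "0 \<le> x 0" "x 0 \<le> 1"
    and "\<And>i. i < k \<Longrightarrow> edge_constraints (x i) (x (Suc i)) (y i)"
    and "\<And>i. i < k \<Longrightarrow> d i = x i + x (Suc i) - 2 * y i"
  shows "\<bar>x 0 - x k\<bar> \<le> flip_cost d k False \<and> \<bar>1 - x 0 - x k\<bar> \<le> flip_cost d k True"
  using assms(3,4)
proof (induction k)
  case (Suc k)
  have "edge_constraints (x k) (x (Suc k)) (y k)" "d k = x k + x (Suc k) - 2 * y k"
    using Suc.prems by auto
  then have "\<bar>x k - x (Suc k)\<bar> \<le> d k" "d k \<le> x k + x (Suc k)" "d k \<le> 2 - x k - x (Suc k)"
    by (auto simp: edge_constraints_def)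
  moreover have "\<bar>x 0 - x k\<bar> \<le> flip_cost d k False" "\<bar>1 - x 0 - x k\<bar> \<le> flip_cost d k True"
    using Suc by auto
  ultimately show ?case by (auto simp: min_def abs_if split: if_splits)
qed (use assms in auto)

text \<open>A choice of terms is encoded as a set \<open>R\<close> of vertices to be switched: edge
  \<open>i\<close> contributes \<open>1 - d i\<close> iff it leaves \<open>R\<close>. Vertex 0 stays
  outside, so membership of \<open>k\<close> records the parity. The bound below 1 excludes the
  artificial value at \<open>k = 0\<close>.\<close>

lemma flip_cost_attained:
  assumes "\<And>i. i < k \<Longrightarrow> 0 \<le> d i \<and> d i \<le> 1" and "flip_cost d k b < 1"
  shows "\<exists>R\<subseteq>{1..k}. (k \<in> R \<longleftrightarrow> b) \<and>
           flip_cost d k b = (\<Sum>i<k. if i \<in> R \<longleftrightarrow> Suc i \<in> R then d i else 1 - d i)"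
  using assms
proof (induction k arbitrary: b)
  case 0
  then show ?case by (cases b) auto
next
  case (Suc k)
  let ?s = "\<lambda>k R. \<Sum>i<k. if i \<in> R \<longleftrightarrow> Suc i \<in> R then d i else 1 - d i"
  have dk: "0 \<le> d k" "d k \<le> 1" using Suc.prems by auto
  \<comment> \<open>The parity of the first \<open>k\<close> choices in the branch where the minimum
    is attained.\<close>
  define b' where "b' = (if flip_cost d k b + d k \<le> flip_cost d k (\<not> b) + 1 - d k then b else \<not> b)"
  have eq: "flip_cost d (Suc k) b = flip_cost d k b' + (if b' = b then d k else 1 - d k)"
    by (auto simp: b'_def)
  then have "flip_cost d k b' < 1"
    using Suc.prems(2) dk by (auto split: if_splits)
  then obtain R where R: "R \<subseteq> {1..k}" "k \<in> R \<longleftrightarrow> b'" "flip_cost d k b' = ?s k R"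
    using Suc.IH[of b'] Suc.prems(1) by (meson less_Suc_eq)
  define R' where "R' = (if b then insert (Suc k) R else R)"
  have R'_iff: "i \<in> R' \<longleftrightarrow> i \<in> R" if "i \<le> k" for i
    using that by (auto simp: R'_def)
  have Suc_k: "Suc k \<in> R' \<longleftrightarrow> b"
    using R(1) by (auto simp: R'_def)
  have "?s (Suc k) R' = ?s k R + (if b' = b then d k else 1 - d k)"
    using R(2) Suc_k by (auto simp: R'_iff intro!: sum.cong)
  moreover have "R' \<subseteq> {1..Suc k}"
    using R(1) by (auto simp: R'_def)
  ultimately show ?case
    using R(3) Suc_k eq by (intro exI[of _ R']) simp
qed

text \<open>Here \<open>a\<close>, \<open>b\<close>, \<open>x\<close> belong to the vertices 0,
  \<open>k\<close>, \<open>Suc k\<close> of a path, \<open>F\<close> and \<open>G\<close> are the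
  even and odd costs up to \<open>k\<close>, and \<open>cyc\<close> is one unfolding of
  \<open>flip_cost\<close>. All demands on the chord \<open>w\<close> from 0 to \<open>k\<close> are
  bounds on \<open>a + b - 2 * w\<close>. As each lower bound is at most each upper bound, the
  largest lower bound \<open>t\<close> can be taken.\<close>

lemma chord_exists:
  assumes e: "edge_constraints b x y" and f: "edge_constraints a x z"
    and E: "1 \<le> F + G" "\<bar>a - b\<bar> \<le> F" "\<bar>1 - a - b\<bar> \<le> G"
    and d: "d = b + x - 2 * y" and d': "d' = a + x - 2 * z"
    and cyc: "1 - d' \<le> min (G + d) (F + 1 - d)" "d' \<le> min (F + d) (G + 1 - d)"
  obtains w where "edge_constraints a b w" "1 - G \<le> a + b - 2 * w" "a + b - 2 * w \<le> F"
    "\<bar>d - d'\<bar> \<le> a + b - 2 * w" "a + b - 2 * w \<le> d + d'" "a + b - 2 * w \<le> 2 - d - d'"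
proof -
  define t where "t = max (1 - G) (max \<bar>a - b\<bar> \<bar>d - d'\<bar>)"
  note defs = e[unfolded edge_constraints_def] f[unfolded edge_constraints_def]
  have lower: "1 - G \<le> t" "\<bar>a - b\<bar> \<le> t" "\<bar>d - d'\<bar> \<le> t"
    by (auto simp: t_def)
  have cyc': "1 - d' \<le> G + d" "1 - d' \<le> F + 1 - d" "d' \<le> F + d" "d' \<le> G + 1 - d"
    using cyc by simp_all
  have F: "t \<le> F"
    unfolding t_def max.bounded_iff using E cyc' by (intro conjI; linarith)
  have ab: "t \<le> a + b" "t \<le> 2 - a - b"
    unfolding t_def max.bounded_iff using defs E d d' by (intro conjI; linarith)+
  have dd: "t \<le> d + d'" "t \<le> 2 - d - d'"
    unfolding t_def max.bounded_iff using defs cyc' d d' by (intro conjI; linarith)+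
  have ec: "edge_constraints a b ((a + b - t) / 2)"
    using lower(2) ab
    by (simp add: edge_constraints_def abs_le_iff field_simps)
  have t: "a + b - 2 * ((a + b - t) / 2) = t"
    by (simp add: field_simps)
  show ?thesis
    by (rule that[OF ec]; unfold t; fact lower F dd)
qed

text \<open>Three bits with given pair marginals have a joint law once the edge and triangle
  inequalities hold. \<open>qab\<close> is the probability that the first two bits are
  \<open>a\<close>, \<open>b\<close> and the third is one.\<close>

lemma triangle_coupling:
  assumes "edge_constraints b x y" and "edge_constraints a x z" and "edge_constraints a b w"
    and d: "d = b + x - 2 * y" "d' = a + x - 2 * z" "t = a + b - 2 * w"
    and "\<bar>d - d'\<bar> \<le> t" "t \<le> d + d'" "t \<le> 2 - d - d'"
  obtains q11 q10 q01 q00 where "0 \<le> q11" "q11 \<le> w" "0 \<le> q10" "q10 \<le> a - w"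
    "0 \<le> q01" "q01 \<le> b - w" "0 \<le> q00" "q00 \<le> 1 - a - b + w"
    "q11 + q01 = y" "q11 + q10 = z" "q11 + q10 + q01 + q00 = x"
proof -
  have edges: "0 \<le> y" "y \<le> b" "y \<le> x" "b + x \<le> 1 + y" "0 \<le> z" "z \<le> a" "z \<le> x" "a + x \<le> 1 + z"
      "0 \<le> w" "w \<le> a" "w \<le> b" "a + b \<le> 1 + w"
    using assms(1-3) unfolding edge_constraints_def by blast+
  have "d - d' \<le> t" "d' - d \<le> t" "t \<le> d + d'" "t \<le> 2 - d - d'"
    using assms(7-) by linarith+
  then have "w + y \<le> z + b" "w + z \<le> y + a" "y + z \<le> w + x" "a + b + x \<le> 1 + y + z + w"
    unfolding d by linarith+
  note ineqs = edges this
  \<comment> \<open>Once \<open>q11\<close> is fixed, the three equations determine the other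
    unknowns; \<open>q\<close> is the largest of the resulting lower bounds for
    \<open>q11\<close>.\<close>
  define q where "q = max (max 0 (y + z - x)) (max (y - (b - w)) (z - (a - w)))"
  have lower: "0 \<le> q" "y + z - x \<le> q" "y - (b - w) \<le> q" "z - (a - w) \<le> q"
    by (auto simp: q_def)
  have upper: "q \<le> w" "q \<le> y" "q \<le> z" "q \<le> 1 - a - b + w + y + z - x"
    unfolding q_def max.bounded_iff using ineqs by (intro conjI; linarith)+
  show ?thesis
    using lower upper by (intro that[of q "z - q" "y - q" "x - y - z + q"]) auto
qed

lemma sum_Pow_atMost_Suc:
  fixes f :: "nat set \<Rightarrow> 'a::comm_monoid_add"
  shows "(\<Sum>A\<in>Pow {..Suc k}. f A) = (\<Sum>A\<in>Pow {..k}. f A + f (insert (Suc k) A))"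
proof -
  have "Pow {..Suc k} = Pow {..k} \<union> insert (Suc k) ` Pow {..k}"
    by (simp add: atMost_Suc Pow_insert)
  moreover have "Pow {..k} \<inter> insert (Suc k) ` Pow {..k} = {}"
    by auto
  moreover have "inj_on (insert (Suc k)) (Pow {..k})"
    by (rule inj_onI) (metis PowD Suc_n_not_le_n atMost_iff insert_ident subsetD)
  ultimately show ?thesis
    by (simp add: sum.union_disjoint sum.reindex sum.distrib)
qed

text \<open>A Markov chain in which the law of the next state depends on the current and on the initial state.\<close>

lemma path_coupling:
  assumes x0: "0 \<le> x 0" "x 0 \<le> 1"
    and edge: "\<And>i. i < k \<Longrightarrow> edge_constraints (x i) (x (Suc i)) (y i)"
    and d: "\<And>i. i < k \<Longrightarrow> d i = x i + x (Suc i) - 2 * y i"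
    and "edge_constraints (x 0) (x k) z"
    and "1 - flip_cost d k True \<le> x 0 + x k - 2 * z" "x 0 + x k - 2 * z \<le> flip_cost d k False"
  shows "\<exists>\<mu> :: nat set \<Rightarrow> real. (\<forall>A. 0 \<le> \<mu> A) \<and> (\<Sum>A\<in>Pow {..k}. \<mu> A) = 1 \<and>
           (\<forall>i\<le>k. (\<Sum>A\<in>Pow {..k}. \<mu> A * of_bool (i \<in> A)) = x i) \<and>
           (\<forall>i<k. (\<Sum>A\<in>Pow {..k}. \<mu> A * (of_bool (i \<in> A) * of_bool (Suc i \<in> A))) = y i) \<and>
           (\<Sum>A\<in>Pow {..k}. \<mu> A * (of_bool (0 \<in> A) * of_bool (k \<in> A))) = z"
  using edge d assms(5-)
proof (induction k arbitrary: z)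
  case 0
  \<comment> \<open>For the empty path the chord joins vertex 0 to itself, and the even cost 0
    forces the marginal of a bit with itself.\<close>
  have "z = x 0"
    using 0 by (simp add: edge_constraints_def)
  moreover have "Pow {..0 :: nat} = {{}, {0}}" by auto
  ultimately show ?case
    using x0 by (intro exI[of _ "\<lambda>A. if 0 \<in> A then x 0 else 1 - x 0"]) auto
next
  case (Suc k)
  have edges: "edge_constraints (x k) (x (Suc k)) (y k)"
    and d_eq: "d k = x k + x (Suc k) - 2 * y k"
    using Suc.prems by auto
  have d_bounds: "0 \<le> d i \<and> d i \<le> 1" if "i < k" for i
    using Suc.prems(1)[of i] Suc.prems(2)[of i] that by (auto simp: edge_constraints_def)
  have "\<bar>x 0 - x k\<bar> \<le> flip_cost d k False \<and> \<bar>1 - x 0 - x k\<bar> \<le> flip_cost d k True"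
    using x0 Suc.prems by (intro flip_cost_ge_dist[where y = y]) auto
  moreover have "1 \<le> flip_cost d k False + flip_cost d k True"
    by (rule flip_cost_sum_ge_1) (rule d_bounds)
  moreover have "1 - (x 0 + x (Suc k) - 2 * z) \<le> min (flip_cost d k True + d k) (flip_cost d k False + 1 - d k)"
    "x 0 + x (Suc k) - 2 * z \<le> min (flip_cost d k False + d k) (flip_cost d k True + 1 - d k)"
    using Suc.prems(4,5) by auto
  \<comment> \<open>The chord value \<open>w\<close> closes the shorter path, as the induction
    hypothesis requires, and completes a triangle with the new edge \<open>y k\<close> and the new
    chord \<open>z\<close>.\<close>
  ultimately obtain w where w: "edge_constraints (x 0) (x k) w"
      "1 - flip_cost d k True \<le> x 0 + x k - 2 * w" "x 0 + x k - 2 * w \<le> flip_cost d k False"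
    and w': "\<bar>d k - (x 0 + x (Suc k) - 2 * z)\<bar> \<le> x 0 + x k - 2 * w"
      "x 0 + x k - 2 * w \<le> d k + (x 0 + x (Suc k) - 2 * z)"
      "x 0 + x k - 2 * w \<le> 2 - d k - (x 0 + x (Suc k) - 2 * z)"
    using chord_exists[OF edges Suc.prems(3) _ _ _ d_eq refl] by blast
  have "\<exists>\<mu> :: nat set \<Rightarrow> real. (\<forall>A. 0 \<le> \<mu> A) \<and> (\<Sum>A\<in>Pow {..k}. \<mu> A) = 1 \<and>
           (\<forall>i\<le>k. (\<Sum>A\<in>Pow {..k}. \<mu> A * of_bool (i \<in> A)) = x i) \<and>
           (\<forall>i<k. (\<Sum>A\<in>Pow {..k}. \<mu> A * (of_bool (i \<in> A) * of_bool (Suc i \<in> A))) = y i) \<and>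
           (\<Sum>A\<in>Pow {..k}. \<mu> A * (of_bool (0 \<in> A) * of_bool (k \<in> A))) = w"
    by (rule Suc.IH[OF _ _ w]) (use Suc.prems(1,2) in auto)
  then obtain \<mu> :: "nat set \<Rightarrow> real"
    where \<mu>: "\<And>A. 0 \<le> \<mu> A" "(\<Sum>A\<in>Pow {..k}. \<mu> A) = 1"
      "\<And>i. i \<le> k \<Longrightarrow> (\<Sum>A\<in>Pow {..k}. \<mu> A * of_bool (i \<in> A)) = x i"
      "\<And>i. i < k \<Longrightarrow> (\<Sum>A\<in>Pow {..k}. \<mu> A * (of_bool (i \<in> A) * of_bool (Suc i \<in> A))) = y i"
      "(\<Sum>A\<in>Pow {..k}. \<mu> A * (of_bool (0 \<in> A) * of_bool (k \<in> A))) = w"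
    by blast
  obtain q11 q10 q01 q00 where q: "0 \<le> q11" "q11 \<le> w" "0 \<le> q10" "q10 \<le> x 0 - w"
      "0 \<le> q01" "q01 \<le> x k - w" "0 \<le> q00" "q00 \<le> 1 - x 0 - x k + w"
      "q11 + q01 = y k" "q11 + q10 = z" "q11 + q10 + q01 + q00 = x (Suc k)"
    using triangle_coupling[OF edges Suc.prems(3) w(1) d_eq refl refl w'] by blast
  \<comment> \<open>\<open>\<pi>\<close> is the joint law of the bits 0 and \<open>k\<close>,
    \<open>q\<close> its part on which the next bit is to be one, and \<open>h\<close> the
    conditional probability. If \<open>\<pi> a b = 0\<close>, then \<open>q a b = 0\<close> as well,
    so division by zero does no harm.\<close>
  define \<pi> where "\<pi> a b = (if a then if b then w else x 0 - w else if b then x k - w else 1 - x 0 - x k + w)" for a b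
  define q where "q a b = (if a then if b then q11 else q10 else if b then q01 else q00)" for a b
  define h where "h a b = q a b / \<pi> a b" for a b
  have q_bounds: "0 \<le> q a b" "q a b \<le> \<pi> a b" for a b
    using q by (auto simp: q_def \<pi>_def)
  have h_bounds: "0 \<le> h a b" "h a b \<le> 1" for a b
    using q_bounds[of a b] by (auto simp: h_def divide_le_eq_1)
  have h_\<pi>: "h a b * \<pi> a b = q a b" for a b
    using q_bounds[of a b] by (cases "\<pi> a b = 0") (auto simp: h_def)
  \<comment> \<open>Given the old bits, the bit \<open>Suc k\<close> is drawn to be one with
    probability \<open>h\<close>.\<close>
  define \<nu> where "\<nu> A = \<mu> (A \<inter> {..k}) * (if Suc k \<in> A then h (0 \<in> A) (k \<in> A) else 1 - h (0 \<in> A) (k \<in> A))" for A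
  have \<nu>_0: "\<nu> A = \<mu> A * (1 - h (0 \<in> A) (k \<in> A))"
    and \<nu>_1: "\<nu> (insert (Suc k) A) = \<mu> A * h (0 \<in> A) (k \<in> A)" if "A \<in> Pow {..k}" for A
  proof -
    have "A \<inter> {..k} = A" "insert (Suc k) A \<inter> {..k} = A" "Suc k \<notin> A"
      using that by auto
    then show "\<nu> A = \<mu> A * (1 - h (0 \<in> A) (k \<in> A))"
      "\<nu> (insert (Suc k) A) = \<mu> A * h (0 \<in> A) (k \<in> A)"
      by (simp_all add: \<nu>_def)
  qed
  have old: "(\<Sum>A\<in>Pow {..Suc k}. \<nu> A * g A) = (\<Sum>A\<in>Pow {..k}. \<mu> A * g A)"
    if "\<And>A. A \<in> Pow {..k} \<Longrightarrow> g (insert (Suc k) A) = g A" for g :: "nat set \<Rightarrow> real"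
    unfolding sum_Pow_atMost_Suc
    by (intro sum.cong refl) (simp add: \<nu>_0 \<nu>_1 that algebra_simps)
  have new: "(\<Sum>A\<in>Pow {..Suc k}. \<nu> A * (g A * of_bool (Suc k \<in> A))) =
      (\<Sum>A\<in>Pow {..k}. \<mu> A * (g A * h (0 \<in> A) (k \<in> A)))"
    if "\<And>A. A \<in> Pow {..k} \<Longrightarrow> g (insert (Suc k) A) = g A" for g :: "nat set \<Rightarrow> real"
    unfolding sum_Pow_atMost_Suc
  proof (intro sum.cong refl)
    fix A assume A: "A \<in> Pow {..k}"
    then have "Suc k \<notin> A" by auto
    then show "\<nu> A * (g A * of_bool (Suc k \<in> A)) +
        \<nu> (insert (Suc k) A) * (g (insert (Suc k) A) * of_bool (Suc k \<in> insert (Suc k) A)) =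
        \<mu> A * (g A * h (0 \<in> A) (k \<in> A))"
      using A by (simp add: \<nu>_1 that)
  qed
  \<comment> \<open>Every function of two bits is a combination of 1, the bits and their product, so
    the known marginals determine its expectation.\<close>
  have law: "(\<Sum>A\<in>Pow {..k}. \<mu> A * G (0 \<in> A) (k \<in> A)) =
      G True True * \<pi> True True + G True False * \<pi> True False +
      G False True * \<pi> False True + G False False * \<pi> False False" for G :: "bool \<Rightarrow> bool \<Rightarrow> real"
  proof -
    let ?c = "G True True - G True False - G False True + G False False"
    have "(\<Sum>A\<in>Pow {..k}. \<mu> A * G (0 \<in> A) (k \<in> A)) = (\<Sum>A\<in>Pow {..k}. G False False * \<mu> A
        + (G True False - G False False) * (\<mu> A * of_bool (0 \<in> A))
        + (G False True - G False False) * (\<mu> A * of_bool (k \<in> A))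
        + ?c * (\<mu> A * (of_bool (0 \<in> A) * of_bool (k \<in> A))))"
    proof (rule sum.cong[OF refl])
      fix A
      show "\<mu> A * G (0 \<in> A) (k \<in> A) = G False False * \<mu> A
        + (G True False - G False False) * (\<mu> A * of_bool (0 \<in> A))
        + (G False True - G False False) * (\<mu> A * of_bool (k \<in> A))
        + ?c * (\<mu> A * (of_bool (0 \<in> A) * of_bool (k \<in> A)))"
        by (cases "0 \<in> A"; cases "k \<in> A") (simp_all add: algebra_simps)
    qed
    also have "\<dots> = G False False * 1 + (G True False - G False False) * x 0
        + (G False True - G False False) * x k + ?c * w"
      unfolding sum.distrib sum_distrib_left[symmetric] \<mu>(2,5) \<mu>(3)[OF le0] \<mu>(3)[OF order.refl] ..
    finally have "(\<Sum>A\<in>Pow {..k}. \<mu> A * G (0 \<in> A) (k \<in> A)) = G False False * 1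
        + (G True False - G False False) * x 0 + (G False True - G False False) * x k + ?c * w" .
    then show ?thesis
      by (simp add: \<pi>_def algebra_simps)
  qed
  have total: "(\<Sum>A\<in>Pow {..Suc k}. \<nu> A) = 1"
    using old[of "\<lambda>_. 1"] \<mu>(2) by simp
  have vertex: "(\<Sum>A\<in>Pow {..Suc k}. \<nu> A * of_bool (i \<in> A)) = x i" if "i \<le> Suc k" for i
  proof (cases "i = Suc k")
    case True
    have "(\<Sum>A\<in>Pow {..Suc k}. \<nu> A * of_bool (Suc k \<in> A)) = (\<Sum>A\<in>Pow {..k}. \<mu> A * h (0 \<in> A) (k \<in> A))"
      using new[of "\<lambda>_. 1"] by simp
    also have "\<dots> = x (Suc k)"
      using q(11) unfolding law h_\<pi> by (simp add: q_def)
    finally show ?thesis using True by simp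
  next
    case False
    with that have "i \<le> k" by simp
    then show ?thesis
      using \<mu>(3)[of i] by (subst old) auto
  qed
  have edge: "(\<Sum>A\<in>Pow {..Suc k}. \<nu> A * (of_bool (i \<in> A) * of_bool (Suc i \<in> A))) = y i" if "i < Suc k" for i
  proof (cases "i = k")
    case True
    have "(\<Sum>A\<in>Pow {..Suc k}. \<nu> A * (of_bool (k \<in> A) * of_bool (Suc k \<in> A))) =
        (\<Sum>A\<in>Pow {..k}. \<mu> A * (of_bool (k \<in> A) * h (0 \<in> A) (k \<in> A)))"
      by (rule new) auto
    also have "\<dots> = y k"
      using q(9) law[of "\<lambda>a b. of_bool b * h a b"] by (simp add: h_\<pi> q_def)
    finally show ?thesis using True by simp
  next
    case False
    with that have "i < k" by simp
    then show ?thesis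
      using \<mu>(4)[of i] by (subst old) auto
  qed
  have chord: "(\<Sum>A\<in>Pow {..Suc k}. \<nu> A * (of_bool (0 \<in> A) * of_bool (Suc k \<in> A))) = z"
  proof -
    have "(\<Sum>A\<in>Pow {..Suc k}. \<nu> A * (of_bool (0 \<in> A) * of_bool (Suc k \<in> A))) =
        (\<Sum>A\<in>Pow {..k}. \<mu> A * (of_bool (0 \<in> A) * h (0 \<in> A) (k \<in> A)))"
      by (rule new) auto
    also have "\<dots> = z"
      using q(10) law[of "\<lambda>a b. of_bool a * h a b"] by (simp add: h_\<pi> q_def)
    finally show ?thesis .
  qed
  have nonneg: "0 \<le> \<nu> A" for A
    unfolding \<nu>_def by (intro mult_nonneg_nonneg) (simp_all add: \<mu>(1) h_bounds)
  show ?case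
    by (intro exI[of _ \<nu>] conjI allI impI total vertex edge chord nonneg)
qed

section \<open>Order polytopes\<close>

text \<open>Subtracting from each coordinate its predecessor in the order of \<open>f\<close> is
  triangular with unit diagonal and maps \<open>S\<close> onto the open standard simplex: the gaps
  are positive, and their sum telescopes to the largest coordinate.\<close>

lemma measure_chain_simplex:
  fixes f :: "'n::finite \<Rightarrow> nat"
  assumes f: "bij_betw f UNIV {..<CARD('n)}"
  defines "S \<equiv> {p :: real ^ 'n. (\<forall>k. 0 < p $ k \<and> p $ k < 1) \<and> (\<forall>i j. f i < f j \<longrightarrow> p $ i < p $ j)}"
  shows "S \<in> sets borel" "measure lborel S = 1 / fact CARD('n)"
proof -
  let ?N = "CARD('n)"
  define h where "h = inv_into UNIV f"
  have h: "bij_betw h {..<?N} UNIV"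
    unfolding h_def using f by (rule bij_betw_inv_into)
  have hf [simp]: "h (f k) = k" for k
    using f by (simp add: h_def bij_betw_def)
  have fh [simp]: "f (h i) = i" if "i < ?N" for i
    using f that by (simp add: h_def bij_betw_inv_into_right)
  have f_less: "f k < ?N" for k
    using f by (auto simp: bij_betw_def)
  define g where "g k p = (if f k = 0 then 0 else - p $ h (f k - 1))" for k and p :: "real ^ 'n"
  define L where "L p = (\<chi> k. p $ k + g k p)" for p
  have L: "L p $ k = 1 * p $ k + g k p" for p k
    by (simp add: L_def)
  have g_meas [measurable]: "g k \<in> borel_measurable borel" for k
    unfolding g_def by simp
  have dep: "g k p = g k q" if "\<And>j. f j < f k \<Longrightarrow> p $ j = q $ j" for k p q
  proof (cases "f k = 0")
    case False
    then have "f k - 1 < ?N" "f k - 1 < f k"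
      using f_less[of k] by auto
    with that[of "h (f k - 1)"] False show ?thesis by (simp add: g_def)
  qed (simp add: g_def)
  let ?I = "{w :: real ^ 'n. (\<forall>i. 0 < w $ i) \<and> (\<Sum>i\<in>UNIV. w $ i) < 1}"
  have I: "?I \<in> sets borel" by measurable
  have telescope: "(\<Sum>i<Suc n. L p $ h i) = p $ h n" if "n < ?N" for n p
    using that
  proof (induction n)
    case (Suc n)
    then show ?case by (simp add: L g_def)
  qed (simp add: L g_def)
  have sum_L: "(\<Sum>k\<in>UNIV. L p $ k) = p $ h (?N - 1)" for p
  proof -
    have "(\<Sum>k\<in>UNIV. L p $ k) = (\<Sum>i<?N. L p $ h i)"
      using h by (rule sum.reindex_bij_betw[symmetric])
    also have "\<dots> = p $ h (?N - 1)"
      using telescope[of "?N - 1" p] by simp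
    finally show ?thesis .
  qed
  have S: "S = L -` ?I"
  proof (intro set_eqI iffI)
    fix p assume p: "p \<in> S"
    have "0 < L p $ k" for k
    proof (cases "f k = 0")
      case True
      then show ?thesis using p by (simp add: L g_def S_def)
    next
      case False
      then have "f (h (f k - 1)) < f k"
        using f_less[of k] by simp
      then have "p $ h (f k - 1) < p $ k"
        using p by (simp add: S_def)
      with False show ?thesis by (simp add: L g_def)
    qed
    then show "p \<in> L -` ?I"
      using p by (simp add: sum_L S_def)
  next
    fix p assume "p \<in> L -` ?I"
    then have pos: "0 < L p $ k" and sum: "p $ h (?N - 1) < 1" for k
      using sum_L[of p] by auto
    have step: "p $ h i < p $ h (Suc i)" if "Suc i < ?N" for i
      using pos[of "h (Suc i)"] that by (simp add: L g_def)
    have mono: "p $ h i < p $ h j" if "i < j" "j < ?N" for i j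
      using that
    proof (induction j)
      case (Suc j)
      then show ?case using step[of j] by (cases "i = j") auto
    qed simp
    have "0 < p $ h 0"
      using pos[of "h 0"] by (simp add: L g_def)
    then have "0 < p $ k" for k
      using mono[of 0 "f k"] f_less[of k] by (cases "f k = 0") (auto, metis hf)
    moreover have "p $ k < 1" for k
    proof (cases "f k = ?N - 1")
      case True
      then have "k = h (?N - 1)" by (metis hf)
      with sum show ?thesis by simp
    next
      case False
      then have "f k < ?N - 1"
        using f_less[of k] by linarith
      from mono[OF this] have "p $ k < p $ h (?N - 1)"
        by simp
      with sum show ?thesis by linarith
    qed
    moreover have "p $ i < p $ j" if "f i < f j" for i j
      using mono[OF that] f_less[of j] by simp
    ultimately show "p \<in> S"
      by (simp add: S_def)
  qed
  show "S \<in> sets borel"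
    unfolding S by (rule emeasure_triangular_vimage(1)[of L "\<lambda>_. 1" g f, OF L _ g_meas dep I]) simp
  show "measure lborel S = 1 / fact ?N"
    unfolding S using measure_triangular_vimage[of L "\<lambda>_. 1" g f, OF L _ g_meas dep I]
    by (simp add: measure_std_simplex)
qed

lemma measure_lborel_null_subset:
  fixes N :: "'a::euclidean_space set"
  assumes "negligible M" "N \<subseteq> M" "N \<in> sets borel"
  shows "N \<in> null_sets lborel"
proof -
  have "negligible N"
    using assms(1,2) by (rule negligible_subset)
  then have "N \<in> null_sets lebesgue"
    by (simp add: negligible_iff_null_sets)
  then show ?thesis
    using assms(3) by (simp add: null_sets_def)
qed

lemma negligible_equal_coordinates:
  assumes "i \<noteq> j"
  shows "negligible {p :: real ^ 'n::finite. p $ i = p $ j}"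
proof -
  have "{p :: real ^ 'n. p $ i = p $ j} = {p. (axis i 1 - axis j 1) \<bullet> p = 0}"
    by (auto simp: inner_diff_left inner_axis')
  moreover have "(axis i 1 - axis j 1 :: real ^ 'n) \<noteq> 0"
    using assms by (simp add: axis_eq_axis)
  ultimately show ?thesis
    by (simp add: negligible_hyperplane)
qed

text \<open>Up to null sets, the order polytope is the disjoint union of the simplices of its linear extensions.\<close>

lemma measure_order_polytope:
  fixes r :: "('n::finite \<times> 'n) set"
  assumes irrefl: "\<And>i. (i, i) \<notin> r"
  shows "measure lborel {p :: real ^ 'n. (\<forall>k. 0 \<le> p $ k \<and> p $ k < 1) \<and> (\<forall>(i, j)\<in>r. p $ i \<le> p $ j)}
    = card {f. bij_betw f UNIV {..<CARD('n)} \<and> (\<forall>(i, j)\<in>r. f i < f j)} / fact CARD('n)"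
    (is "measure lborel ?O = card ?F / _")
proof -
  define S where "S f = {p :: real ^ 'n. (\<forall>k. 0 < p $ k \<and> p $ k < 1) \<and> (\<forall>i j. f i < f j \<longrightarrow> p $ i < p $ j)}"
    for f :: "'n \<Rightarrow> nat"
  have finF: "finite ?F"
  proof (rule finite_subset)
    show "?F \<subseteq> (UNIV :: 'n set) \<rightarrow>\<^sub>E {..<CARD('n)}"
      by (auto simp: bij_betw_def)
  qed (simp add: finite_PiE)
  have S: "S f \<in> sets borel" "measure lborel (S f) = 1 / fact CARD('n)" if "f \<in> ?F" for f
    using measure_chain_simplex[of f] that by (auto simp: S_def)
  have [measurable]: "?O \<in> sets borel"
  proof -
    have "?O = {p. (\<forall>k. 0 \<le> p $ k \<and> p $ k < 1) \<and> (\<forall>i j. (i, j) \<in> r \<longrightarrow> p $ i \<le> p $ j)}"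
      by auto
    then show ?thesis
      by (simp only:) measurable
  qed
  have S_sub: "S f \<subseteq> ?O" if "f \<in> ?F" for f
    using that by (fastforce simp: S_def intro: less_imp_le)
  have disj: "disjoint_family_on S ?F"
  proof (unfold disjoint_family_on_def, intro ballI impI equals0I)
    fix f f' p assume f: "f \<in> ?F" "f' \<in> ?F" "f \<noteq> f'" and p: "p \<in> S f \<inter> S f'"
    \<comment> \<open>A point of a simplex determines its linear extension by counting smaller
      coordinates, so different simplices are disjoint.\<close>
    have rank: "g k = card {j. p $ j < p $ k}" if "g \<in> ?F" "p \<in> S g" for g k
    proof -
      have bij: "bij_betw g UNIV {..<CARD('n)}" using that by simp
      have "p $ j < p $ k \<longleftrightarrow> g j < g k" for j
        using that(2) bij by (auto simp: S_def bij_betw_def inj_def) (metis linorder_neqE_nat order_less_asym order_less_irrefl)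
      then have "{j. p $ j < p $ k} = {j. g j < g k}" by simp
      moreover have "bij_betw g {j. g j < g k} {..<g k}"
      proof -
        have "g ` {j. g j < g k} = {..<g k}"
        proof (intro equalityI subsetI)
          fix i assume "i \<in> {..<g k}"
          moreover have "g k < CARD('n)" using bij by (auto simp: bij_betw_def)
          ultimately have "i \<in> g ` UNIV" using bij by (auto simp: bij_betw_def)
          then show "i \<in> g ` {j. g j < g k}" using \<open>i \<in> {..<g k}\<close> by auto
        qed auto
        then show ?thesis using bij by (auto simp: bij_betw_def intro: inj_on_subset)
      qed
      ultimately show ?thesis
        using bij_betw_same_card by fastforce
    qed
    have "f k = f' k" for k
      using rank[of f k] rank[of f' k] f p by auto
    with f(3) show False by auto
  qed
  have fin: "emeasure lborel A \<noteq> \<infinity>" if "A \<subseteq> ?O" for A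
  proof -
    have "?O \<subseteq> cbox 0 (\<chi> i. 1)"
    proof
      fix p assume "p \<in> ?O"
      then have "0 \<le> p $ i" "p $ i < 1" for i
        by auto
      then show "p \<in> cbox 0 (\<chi> i. 1)"
        by (simp add: mem_box_cart order_less_imp_le)
    qed
    then have "bounded A"
      by (rule bounded_subset[OF bounded_cbox order_trans[OF that]])
    then show ?thesis
      using emeasure_bounded_finite by (metis less_irrefl)
  qed
  have cover: "?O - (\<Union>f\<in>?F. S f) \<subseteq> (\<Union>i. {p. p $ i = 0}) \<union> (\<Union>i. \<Union>j\<in>- {i}. {p. p $ i = p $ j})"
  proof (rule subsetI, rule ccontr)
    fix p assume p: "p \<in> ?O - (\<Union>f\<in>?F. S f)"
      and "p \<notin> (\<Union>i. {p. p $ i = 0}) \<union> (\<Union>i. \<Union>j\<in>- {i}. {p. p $ i = p $ j})"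
    then have nz: "p $ i \<noteq> 0" and ne: "i \<noteq> j \<Longrightarrow> p $ i \<noteq> p $ j" for i j
      by auto
    \<comment> \<open>Conversely, a point with distinct coordinates, all nonzero, lies in the
      simplex of its own ranking.\<close>
    define f where "f k = card {j. p $ j < p $ k}" for k
    have less: "f i < f j" if "p $ i < p $ j" for i j
      unfolding f_def using that by (intro psubset_card_mono) auto
    have inj: "inj f"
      by (rule injI) (metis less linorder_neqE_linordered_idom ne order_less_irrefl)
    have f_less: "f k < CARD('n)" for k
      unfolding f_def by (intro psubset_card_mono) auto
    have "f ` UNIV = {..<CARD('n)}"
      by (rule card_subset_eq) (use f_less inj in \<open>auto simp: card_image\<close>)
    with inj have "bij_betw f UNIV {..<CARD('n)}"
      by (simp add: bij_betw_def)
    moreover have "f i < f j" if "(i, j) \<in> r" for i j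
    proof (rule less)
      have "i \<noteq> j" using that irrefl by auto
      then show "p $ i < p $ j"
        using ne[of i j] p that by fastforce
    qed
    ultimately have "f \<in> ?F" by auto
    moreover have "p \<in> S f"
      unfolding S_def
    proof (intro CollectI conjI allI impI)
      show "0 < p $ k" "p $ k < 1" for k
        using p nz[of k] by (auto simp: less_le)
      show "p $ i < p $ j" if "f i < f j" for i j
        using that less[of j i] ne[of i j] by (metis linorder_neqE_linordered_idom order_less_asym order_less_irrefl)
    qed
    ultimately show False using p by auto
  qed
  have US: "(\<Union>f\<in>?F. S f) \<in> sets borel"
    using S(1) finF by (intro sets.finite_UN) auto
  have "?O - (\<Union>f\<in>?F. S f) \<in> null_sets lborel"
  proof (rule measure_lborel_null_subset[OF _ cover])
    show "negligible ((\<Union>i. {p :: real ^ 'n. p $ i = 0}) \<union> (\<Union>i. \<Union>j\<in>- {i}. {p. p $ i = p $ j}))"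
      by (auto intro!: negligible_Un negligible_Union negligible_equal_coordinates negligible_standard_hyperplane_cart)
  qed (use US in measurable)
  then have "measure lborel (?O - (?O - (\<Union>f\<in>?F. S f))) = measure lborel ?O"
    by (intro measure_Diff_null_set) auto
  also have "?O - (?O - (\<Union>f\<in>?F. S f)) = (\<Union>f\<in>?F. S f)"
    using S_sub by blast
  finally have "measure lborel ?O = measure lborel (\<Union>f\<in>?F. S f)" ..
  also have "\<dots> = (\<Sum>f\<in>?F. measure lborel (S f))"
    using S(1) S_sub fin by (intro measure_finite_Union finF disj) auto
  also have "\<dots> = (\<Sum>f\<in>?F. 1 / fact CARD('n))"
    using S(2) by (intro sum.cong) auto
  finally show ?thesis
    by simp
qed

section \<open>Switching and the cycle inequalities\<close>

text \<open>At a 0/1 point with \<open>y\<close> the product of the end points, each case is the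
  product after complementing the bits in \<open>R\<close>, for example
  \<open>(1 - a) * b = b - y\<close>.\<close>

definition switch :: "('e::finite \<Rightarrow> 'v::finite \<times> 'v) \<Rightarrow> 'v set \<Rightarrow> real ^ ('v + 'e) \<Rightarrow> real ^ ('v + 'e)" where
  "switch ends R p = (\<chi> k. case k of
     Inl u \<Rightarrow> if u \<in> R then 1 - p $ Inl u else p $ Inl u
   | Inr e \<Rightarrow> (let (a, b) = ends e in
       if a \<in> R then if b \<in> R then 1 - p $ Inl a - p $ Inl b + p $ Inr e else p $ Inl b - p $ Inr e
       else if b \<in> R then p $ Inl a - p $ Inr e else p $ Inr e))"

text \<open>The map is triangular when vertices are ranked before edges, and its diagonal entries
  are 1 or -1.\<close>

lemma measure_switch_vimage:
  fixes ends :: "'e::finite \<Rightarrow> 'v::finite \<times> 'v"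
  assumes S: "S \<in> sets borel"
  shows "switch ends R -` S \<in> sets borel"
    and "measure lborel (switch ends R -` S) = measure lborel S"
proof -
  define c where "c k = (case k of Inl u \<Rightarrow> if u \<in> R then -1 else 1
     | Inr e \<Rightarrow> if fst (ends e) \<in> R \<longleftrightarrow> snd (ends e) \<in> R then 1 else (-1 :: real))" for k
  define g :: "'v + 'e \<Rightarrow> real ^ ('v + 'e) \<Rightarrow> real" where "g k p = (case k of
     Inl u \<Rightarrow> of_bool (u \<in> R)
   | Inr e \<Rightarrow> let (a, b) = ends e in
       if a \<in> R then if b \<in> R then 1 - p $ Inl a - p $ Inl b else p $ Inl b
       else if b \<in> R then p $ Inl a else 0)" for k p
  define r :: "'v + 'e \<Rightarrow> nat" where "r k = (case k of Inl u \<Rightarrow> 0 | Inr e \<Rightarrow> 1)" for k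
  have f: "switch ends R p $ k = c k * p $ k + g k p" for p k
    by (auto simp: switch_def c_def g_def split: sum.split prod.split)
  have c: "c k \<noteq> 0" for k
    by (auto simp: c_def split: sum.split)
  have g [measurable]: "g k \<in> borel_measurable borel" for k
  proof (cases k)
    case (Inl u)
    then show ?thesis unfolding g_def by simp
  next
    case (Inr e)
    obtain a b where "ends e = (a, b)" by fastforce
    with Inr have "g k = (\<lambda>p. if a \<in> R then if b \<in> R then 1 - p $ Inl a - p $ Inl b else p $ Inl b
       else if b \<in> R then p $ Inl a else 0)"
      by (simp add: g_def fun_eq_iff)
    then show ?thesis by simp
  qed
  have dep: "g k p = g k q" if "\<And>j. r j < r k \<Longrightarrow> p $ j = q $ j" for k p q
    using that by (auto simp: g_def r_def split: sum.splits prod.splits)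
  have "(\<Prod>k\<in>UNIV. \<bar>c k\<bar>) = 1"
    by (rule prod.neutral) (auto simp: c_def split: sum.split)
  then show "measure lborel (switch ends R -` S) = measure lborel S"
    using measure_triangular_vimage[of "switch ends R" c g r S, OF f c g dep S] by simp
  show "switch ends R -` S \<in> sets borel"
    by (rule emeasure_triangular_vimage(1)[of "switch ends R" c g r S, OF f c g dep S])
qed

text \<open>Labels start at 0 and are continued periodically to all naturals, so that the closing
  edge \<open>m - 1\<close> also runs from \<open>V k\<close> to \<open>V (Suc k)\<close> without
  reduction modulo \<open>m\<close>.\<close>

locale cycle =
  fixes m :: nat and ends :: "'e::finite \<Rightarrow> 'v::finite \<times> 'v" and V :: "nat \<Rightarrow> 'v" and E :: "nat \<Rightarrow> 'e"
  assumes m_ge_3: "m \<ge> 3"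
    and bij_V: "bij_betw V {..<m} UNIV" and bij_E: "bij_betw E {..<m} UNIV"
    and V_period [simp]: "V (k + m) = V k" and E_period [simp]: "E (k + m) = E k"
    and ends_E [simp]: "ends (E k) = (V k, V (Suc k))"
begin

lemma V_m [simp]: "V m = V 0"
  using V_period[of 0] by simp

lemma Suc_last [simp]: "Suc (m - Suc 0) = m"
  using m_ge_3 by simp

lemma V_cases: obtains k where "k < m" "u = V k"
  using bij_V by (metis bij_betw_iff_bijections iso_tuple_UNIV_I lessThan_iff)

lemma E_cases: obtains k where "k < m" "e = E k"
  using bij_E by (metis bij_betw_iff_bijections iso_tuple_UNIV_I lessThan_iff)

lemma V_eq_iff: "j < m \<Longrightarrow> k < m \<Longrightarrow> V j = V k \<longleftrightarrow> j = k"
  using bij_V by (auto simp: bij_betw_def inj_on_def)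

lemma E_eq_iff: "j < m \<Longrightarrow> k < m \<Longrightarrow> E j = E k \<longleftrightarrow> j = k"
  using bij_E by (auto simp: bij_betw_def inj_on_def)

abbreviation x :: "real ^ ('v + 'e) \<Rightarrow> nat \<Rightarrow> real" where
  "x p k \<equiv> p $ Inl (V k)"

abbreviation y :: "real ^ ('v + 'e) \<Rightarrow> nat \<Rightarrow> real" where
  "y p k \<equiv> p $ Inr (E k)"

abbreviation d :: "real ^ ('v + 'e) \<Rightarrow> nat \<Rightarrow> real" where
  "d p k \<equiv> x p k + x p (Suc k) - 2 * y p k"

abbreviation "Q \<equiv> Q_polytope ends"
abbreviation "P \<equiv> P_polytope ends"

lemma mem_Q_iff: "p \<in> Q \<longleftrightarrow> (\<forall>k. edge_constraints (x p k) (x p (Suc k)) (y p k))"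
proof
  assume "p \<in> Q"
  then show "\<forall>k. edge_constraints (x p k) (x p (Suc k)) (y p k)"
    unfolding Q_polytope_def edge_constraints_def using ends_E by blast
next
  assume *: "\<forall>k. edge_constraints (x p k) (x p (Suc k)) (y p k)"
  have x: "0 \<le> x p k" "x p k \<le> 1" and y: "0 \<le> y p k" "y p k \<le> 1" for k
    using *[rule_format, of k] by (auto simp: edge_constraints_def)
  have "0 \<le> p $ k \<and> p $ k \<le> 1" for k
  proof (cases k)
    case (Inl u) then show ?thesis using x by (cases u rule: V_cases) auto
  next
    case (Inr e) then show ?thesis using y by (cases e rule: E_cases) auto
  qed
  moreover have "p $ Inr e \<ge> 0 \<and> p $ Inr e \<le> p $ Inl i \<and> p $ Inr e \<le> p $ Inl j \<and>
      p $ Inl i + p $ Inl j \<le> 1 + p $ Inr e" if "ends e = (i, j)" for e i j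
    using *[unfolded edge_constraints_def] that by (cases e rule: E_cases) auto
  ultimately show "p \<in> Q"
    by (simp add: Q_polytope_def)
qed

lemma Q_edge: "p \<in> Q \<Longrightarrow> edge_constraints (x p k) (x p (Suc k)) (y p k)"
  by (simp add: mem_Q_iff)

lemma Q_bounds:
  assumes "p \<in> Q"
  shows "0 \<le> x p k" "x p k \<le> 1" "0 \<le> d p k" "d p k \<le> 1"
  using Q_edge[OF assms, of k] by (auto simp: edge_constraints_def)

lemma x_switch: "x (switch ends R p) k = (if V k \<in> R then 1 - x p k else x p k)"
  by (simp add: switch_def)

lemma y_switch: "y (switch ends R p) k =
    (if V k \<in> R then if V (Suc k) \<in> R then 1 - x p k - x p (Suc k) + y p k else x p (Suc k) - y p k
     else if V (Suc k) \<in> R then x p k - y p k else y p k)"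
  by (simp add: switch_def)

lemma d_switch: "d (switch ends R p) k = (if V k \<in> R \<longleftrightarrow> V (Suc k) \<in> R then d p k else 1 - d p k)"
  by (auto simp: x_switch y_switch)

lemma switch_mem_Q_iff [simp]: "switch ends R p \<in> Q \<longleftrightarrow> p \<in> Q"
  unfolding mem_Q_iff x_switch y_switch edge_constraints_def
  by (intro all_cong1) (auto simp: algebra_simps)

text \<open>The points of \<open>Q\<close> cut off by the cycle inequality \<open>d\<^sub>m\<^sub>-\<^sub>1 \<le> d\<^sub>0 + \<dots> + d\<^sub>m\<^sub>-\<^sub>2\<close>; those cut off by the
  other cycle inequalities are obtained by switching.\<close>

definition T :: "(real ^ ('v + 'e)) set" where
  "T = {p \<in> Q. (\<Sum>i<m - 1. d p i) < d p (m - 1)}"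

lemma convex_Q: "convex Q"
proof (rule convexI)
  fix p q :: "real ^ ('v + 'e)" and s t :: real
  assume p: "p \<in> Q" and q: "q \<in> Q" and st: "0 \<le> s" "0 \<le> t" "s + t = 1"
  have "edge_constraints (s * x p k + t * x q k) (s * x p (Suc k) + t * x q (Suc k)) (s * y p k + t * y q k)" for k
  proof -
    have "s * (x p k + x p (Suc k)) + t * (x q k + x q (Suc k)) \<le> s * (1 + y p k) + t * (1 + y q k)"
      using Q_edge[OF p, of k] Q_edge[OF q, of k] st(1,2) unfolding edge_constraints_def
      by (intro add_mono[OF mult_left_mono mult_left_mono]) blast+
    also have "\<dots> = 1 + (s * y p k + t * y q k)"
      using st(3) by (simp add: algebra_simps)
    finally have "s * (x p k + x p (Suc k)) + t * (x q k + x q (Suc k)) \<le> 1 + (s * y p k + t * y q k)" .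
    moreover have "s * y p k + t * y q k \<le> s * x p j + t * x q j" if "j = k \<or> j = Suc k" for j
      using Q_edge[OF p, of k] Q_edge[OF q, of k] st(1,2) that
      by (intro add_mono mult_left_mono) (auto simp: edge_constraints_def)
    moreover have "0 \<le> s * y p k + t * y q k"
      using Q_edge[OF p, of k] Q_edge[OF q, of k] st(1,2) by (simp add: edge_constraints_def)
    ultimately show ?thesis
      by (simp add: edge_constraints_def algebra_simps)
  qed
  then show "s *\<^sub>R p + t *\<^sub>R q \<in> Q"
    by (simp add: mem_Q_iff)
qed

text \<open>At a 0/1 point of \<open>P\<close> every switched \<open>d\<close> is the distance of
  the switched end points, so the cycle inequality is the triangle inequality. Switched values of
  \<open>d\<close> are affine in the point, hence the right-hand side is convex.\<close>

lemma P_subset: "P \<subseteq> {p \<in> Q. \<forall>R. switch ends R p \<notin> T}"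
  unfolding P_polytope_def
proof (rule hull_minimal)
  let ?n = "m - 1"
  have n: "Suc ?n = m"
    using m_ge_3 by simp
  show "{p. (\<forall>k. p $ k = 0 \<or> p $ k = 1) \<and> (\<forall>e i j. ends e = (i, j) \<longrightarrow> p $ Inl i * p $ Inl j = p $ Inr e)}
      \<subseteq> {p \<in> Q. \<forall>R. switch ends R p \<notin> T}"
  proof clarify
    fix p :: "real ^ ('v + 'e)"
    assume *: "\<forall>k. p $ k = 0 \<or> p $ k = 1"
      "\<forall>e i j. ends e = (i, j) \<longrightarrow> p $ Inl i * p $ Inl j = p $ Inr e"
    have x: "x p k = 0 \<or> x p k = 1" and y: "y p k = x p k * x p (Suc k)" for k
      using *(1) *(2)[rule_format, OF ends_E[of k]] by auto
    have "edge_constraints (x p k) (x p (Suc k)) (y p k)" for k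
      using x[of k] x[of "Suc k"] by (auto simp: y edge_constraints_def)
    moreover have "switch ends R p \<notin> T" for R
    proof -
      let ?q = "switch ends R p"
      have d: "d ?q k = \<bar>x ?q k - x ?q (Suc k)\<bar>" for k
        unfolding d_switch using x[of k] x[of "Suc k"] by (auto simp: y x_switch)
      have "\<bar>x ?q 0 - x ?q k\<bar> \<le> (\<Sum>i<k. d ?q i)" for k
        by (induction k) (auto simp: d)
      from this[of ?n] show ?thesis
        using d[of ?n] by (simp add: T_def n abs_minus_commute)
    qed
    ultimately show "p \<in> Q \<and> (\<forall>R. switch ends R p \<notin> T)"
      by (simp add: mem_Q_iff)
  qed
  show "convex {p \<in> Q. \<forall>R. switch ends R p \<notin> T}"
  proof (rule convexI)
    fix p q :: "real ^ ('v + 'e)" and s t :: real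
    assume p: "p \<in> {p \<in> Q. \<forall>R. switch ends R p \<notin> T}" and q: "q \<in> {p \<in> Q. \<forall>R. switch ends R p \<notin> T}"
      and st: "0 \<le> s" "0 \<le> t" "s + t = 1"
    have "switch ends R (s *\<^sub>R p + t *\<^sub>R q) \<notin> T" for R
    proof -
      let ?d = "\<lambda>p. d (switch ends R p)"
      have d: "?d (s *\<^sub>R p + t *\<^sub>R q) k = s * ?d p k + t * ?d q k" for k
      proof -
        have "1 - (s * a + t * b) = s * (1 - a) + t * (1 - b)" for a b
          using st(3) by (simp add: algebra_simps)
        then show ?thesis
          unfolding d_switch by (simp add: algebra_simps)
      qed
      have "?d p ?n \<le> (\<Sum>i<?n. ?d p i)" "?d q ?n \<le> (\<Sum>i<?n. ?d q i)"
        using p q by (auto simp: T_def not_less)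
      then have "s * ?d p ?n + t * ?d q ?n \<le> s * (\<Sum>i<?n. ?d p i) + t * (\<Sum>i<?n. ?d q i)"
        using st by (intro add_mono mult_left_mono)
      then have "?d (s *\<^sub>R p + t *\<^sub>R q) ?n \<le> (\<Sum>i<?n. ?d (s *\<^sub>R p + t *\<^sub>R q) i)"
        unfolding d by (simp add: sum.distrib sum_distrib_left)
      then show ?thesis
        by (simp add: T_def)
    qed
    moreover have "s *\<^sub>R p + t *\<^sub>R q \<in> Q"
      using p q st by (intro convexD[OF convex_Q]) auto
    ultimately show "s *\<^sub>R p + t *\<^sub>R q \<in> {p \<in> Q. \<forall>R. switch ends R p \<notin> T}"
      by simp
  qed
qed

text \<open>Sufficiency of the cycle inequalities: they say that the closing edge meets the cost
  bounds for the path through the other edges, so \<open>path_coupling\<close> gives a law of random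
  bits, which is a convex combination of 0/1 points. Since a set and its complement are left by the
  same edges, it suffices to switch at sets avoiding \<open>V 0\<close>.\<close>

lemma Q_subset_P_un_T:
  assumes p: "p \<in> Q" and "\<And>R. V 0 \<notin> R \<Longrightarrow> switch ends R p \<notin> T"
  shows "p \<in> P"
proof -
  let ?n = "m - 1"
  have n: "?n < m" "Suc ?n = m"
    using m_ge_3 by auto
  \<comment> \<open>A choice of terms cheaper than the closing edge allows would be a switching that
    takes \<open>p\<close> into \<open>T\<close>.\<close>
  have no_cut: False if R: "R \<subseteq> {1..?n}" and b: "?n \<in> R \<longleftrightarrow> b"
    and eq: "flip_cost (d p) ?n b = (\<Sum>i<?n. if i \<in> R \<longleftrightarrow> Suc i \<in> R then d p i else 1 - d p i)"
    and less: "flip_cost (d p) ?n b < (if b then 1 - d p ?n else d p ?n)" for R b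
  proof -
    have V_R: "V i \<in> V ` R \<longleftrightarrow> i \<in> R" if "i < m" for i
    proof -
      have "V i = V j \<longleftrightarrow> i = j" if "j \<in> R" for j
        using subsetD[OF R that] \<open>i < m\<close> m_ge_3 by (intro V_eq_iff) auto
      then show ?thesis by (auto intro: rev_image_eqI)
    qed
    have V0: "V 0 \<notin> V ` R"
      using V_R[of 0] R n by auto
    have "(\<Sum>i<?n. d (switch ends (V ` R) p) i) = flip_cost (d p) ?n b"
      unfolding d_switch eq by (intro sum.cong) (auto simp: V_R n)
    \<comment> \<open>The closing edge ends at the unswitched vertex \<open>V 0\<close>, so it
      leaves the switching set iff \<open>b\<close>.\<close>
    moreover have "d (switch ends (V ` R) p) ?n = (if b then 1 - d p ?n else d p ?n)"
      unfolding d_switch unfolding n(2) V_m using V0 b V_R[OF n(1)] by simp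
    ultimately have "switch ends (V ` R) p \<in> T"
      using less p by (simp add: T_def)
    then show False
      using assms(2) V0 by blast
  qed
  have "(if b then 1 - d p ?n else d p ?n) \<le> flip_cost (d p) ?n b" for b
  proof (rule ccontr)
    assume *: "\<not> ?thesis"
    then have "flip_cost (d p) ?n b < 1"
      using Q_bounds[OF p, of ?n] by (auto split: if_splits)
    from flip_cost_attained[OF _ this] obtain R where R: "R \<subseteq> {1..?n}" "?n \<in> R \<longleftrightarrow> b"
      "flip_cost (d p) ?n b = (\<Sum>i<?n. if i \<in> R \<longleftrightarrow> Suc i \<in> R then d p i else 1 - d p i)"
      using Q_bounds[OF p] by blast
    show False
      using no_cut[OF R] * unfolding not_le by blast
  qed
  from this[of True] this[of False]
  have "1 - flip_cost (d p) ?n True \<le> x p 0 + x p ?n - 2 * y p ?n" "x p 0 + x p ?n - 2 * y p ?n \<le> flip_cost (d p) ?n False"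
    by (simp_all add: n algebra_simps)
  moreover have "edge_constraints (x p 0) (x p ?n) (y p ?n)"
    using Q_edge[OF p, of ?n] by (simp add: n edge_constraints_def algebra_simps)
  ultimately obtain \<mu> :: "nat set \<Rightarrow> real" where \<mu>: "\<And>A. 0 \<le> \<mu> A" "(\<Sum>A\<in>Pow {..?n}. \<mu> A) = 1"
      "\<And>i. i \<le> ?n \<Longrightarrow> (\<Sum>A\<in>Pow {..?n}. \<mu> A * of_bool (i \<in> A)) = x p i"
      "\<And>i. i < ?n \<Longrightarrow> (\<Sum>A\<in>Pow {..?n}. \<mu> A * (of_bool (i \<in> A) * of_bool (Suc i \<in> A))) = y p i"
      "(\<Sum>A\<in>Pow {..?n}. \<mu> A * (of_bool (0 \<in> A) * of_bool (?n \<in> A))) = y p ?n"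
    using path_coupling[of "x p" ?n "y p" "d p" "y p ?n"] Q_bounds[OF p] Q_edge[OF p]
    by blast
  \<comment> \<open>The 0/1 point of \<open>P\<close> whose vertex coordinates are the indicator of
    the outcome \<open>A\<close>.\<close>
  define pt :: "nat set \<Rightarrow> real ^ ('v + 'e)" where "pt A = (\<chi> k. case k of
      Inl u \<Rightarrow> of_bool (u \<in> V ` A)
    | Inr e \<Rightarrow> of_bool (fst (ends e) \<in> V ` A) * of_bool (snd (ends e) \<in> V ` A))" for A
  have V_A: "V i \<in> V ` A \<longleftrightarrow> i \<in> A" if "A \<in> Pow {..?n}" "i < m" for i A
  proof -
    have "V i = V j \<longleftrightarrow> i = j" if "j \<in> A" for j
      using that \<open>A \<in> Pow {..?n}\<close> \<open>i < m\<close> m_ge_3 by (intro V_eq_iff) auto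
    then show ?thesis by (auto intro: rev_image_eqI)
  qed
  have pt_P: "pt A \<in> P" for A
    unfolding P_polytope_def by (rule hull_inc) (auto simp: pt_def split: sum.split)
  have "(\<Sum>A\<in>Pow {..?n}. \<mu> A *\<^sub>R pt A) \<in> P"
    by (rule convex_sum) (use \<mu>(1,2) pt_P in \<open>auto simp: P_polytope_def\<close>)
  also have "(\<Sum>A\<in>Pow {..?n}. \<mu> A *\<^sub>R pt A) = p"
  proof -
    have "(\<Sum>A\<in>Pow {..?n}. \<mu> A *\<^sub>R pt A) $ k = p $ k" for k
    proof (cases k)
      case (Inl u)
      obtain i where i: "i < m" "u = V i" by (rule V_cases)
      have "(\<Sum>A\<in>Pow {..?n}. \<mu> A *\<^sub>R pt A) $ k = (\<Sum>A\<in>Pow {..?n}. \<mu> A * of_bool (i \<in> A))"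
        unfolding sum_component by (intro sum.cong refl) (simp add: Inl i pt_def V_A)
      also have "\<dots> = x p i"
        using i n by (intro \<mu>(3)) auto
      finally show ?thesis by (simp add: Inl i)
    next
      case (Inr e)
      obtain i where i: "i < m" "e = E i" by (rule E_cases)
      show ?thesis
      proof (cases "i = ?n")
        case True
        have "(\<Sum>A\<in>Pow {..?n}. \<mu> A *\<^sub>R pt A) $ k = (\<Sum>A\<in>Pow {..?n}. \<mu> A * (of_bool (0 \<in> A) * of_bool (?n \<in> A)))"
          unfolding sum_component
        proof (intro sum.cong refl)
          fix A assume A: "A \<in> Pow {..?n}"
          show "(\<mu> A *\<^sub>R pt A) $ k = \<mu> A * (of_bool (0 \<in> A) * of_bool (?n \<in> A))"
            using V_A[OF A n(1)] V_A[OF A, of 0] m_ge_3 by (simp add: Inr i True pt_def)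
        qed
        also have "\<dots> = y p i"
          using \<mu>(5) True by simp
        finally show ?thesis by (simp add: Inr i)
      next
        case False
        then have "Suc i < m" using i by simp
        then have "(\<Sum>A\<in>Pow {..?n}. \<mu> A *\<^sub>R pt A) $ k = (\<Sum>A\<in>Pow {..?n}. \<mu> A * (of_bool (i \<in> A) * of_bool (Suc i \<in> A)))"
          unfolding sum_component by (intro sum.cong refl) (use i in \<open>simp add: Inr pt_def V_A\<close>)
        also have "\<dots> = y p i"
          using i False by (intro \<mu>(4)) auto
        finally show ?thesis by (simp add: Inr i)
      qed
    qed
    then show ?thesis by (simp add: vec_eq_iff)
  qed
  finally show ?thesis .
qed

text \<open>Both cycle inequalities cannot fail at once: where the symmetric difference of
  \<open>R\<close> and \<open>R'\<close> is entered or left, the two switched values of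
  \<open>d\<close> add up to 1. Adding the two violations bounds the path sum strictly by the
  closing edge, contrary to these contributions.\<close>

lemma switch_T_disjoint:
  assumes "V 0 \<notin> R" "V 0 \<notin> R'" "R \<noteq> R'" and T: "switch ends R p \<in> T" "switch ends R' p \<in> T"
  shows False
proof -
  let ?n = "m - 1"
  have n: "?n < m" "Suc ?n = m"
    using m_ge_3 by auto
  have p: "p \<in> Q"
    using T by (simp add: T_def)
  define D where "D i \<longleftrightarrow> (V i \<in> R \<longleftrightarrow> V i \<notin> R')" for i
  have step: "(if D i \<longleftrightarrow> D (Suc i) then 0 else 1) \<le> d (switch ends R p) i + d (switch ends R' p) i" for i
    using Q_bounds(3,4)[OF p, of i] by (auto simp: d_switch D_def)
  \<comment> \<open>\<open>D\<close> is false at vertex 0, so it has changed at least once if it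
    holds at \<open>k\<close>, and at least twice if it held before but fails at
    \<open>k\<close>.\<close>
  have flips: "(if D k then 1 else if \<exists>j\<le>k. D j then 2 else 0)
      \<le> (\<Sum>i<k. d (switch ends R p) i + d (switch ends R' p) i)" for k
  proof (induction k)
    case 0
    have "\<not> D 0" using assms by (simp add: D_def)
    then show ?case by simp
  next
    case (Suc k)
    then show ?case
      using step[of k] by (auto simp: le_Suc_eq split: if_splits)
  qed
  have "\<exists>u. u \<in> R \<longleftrightarrow> u \<notin> R'"
    using \<open>R \<noteq> R'\<close> by blast
  then obtain j where "j < m" "D j"
    unfolding D_def by (metis V_cases)
  then have "\<exists>j\<le>?n. D j"
    using n by (intro exI[of _ j]) auto
  then have "2 - of_bool (D ?n) \<le> (\<Sum>i<?n. d (switch ends R p) i + d (switch ends R' p) i)"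
    using flips[of ?n] by (auto split: if_splits)
  moreover have "d (switch ends R p) ?n + d (switch ends R' p) ?n \<le> 2 - of_bool (D ?n)"
    using assms(1,2) Q_bounds(3,4)[OF p, of ?n] unfolding d_switch D_def unfolding n V_m by auto
  ultimately show False
    using T by (simp add: T_def sum.distrib)
qed

section \<open>Reduction to one period of the indices\<close>

lemma Q_I:
  assumes "\<And>k. k < m \<Longrightarrow> edge_constraints (x p k) (x p (Suc k)) (y p k)"
  shows "p \<in> Q"
proof -
  have V_mod: "V (k mod m) = V k" "E (k mod m) = E k" for k
  proof -
    have "V (j + i * m) = V j \<and> E (j + i * m) = E j" for i j
      by (induction i) (simp_all add: add.commute[of m] add.assoc[symmetric])
    from this[of "k mod m" "k div m"] show "V (k mod m) = V k" "E (k mod m) = E k"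
      by simp_all
  qed
  have "edge_constraints (x p k) (x p (Suc k)) (y p k)" for k
  proof -
    have "V (Suc (k mod m)) = V (Suc k)"
      using V_mod(1)[of "Suc (k mod m)"] V_mod(1)[of "Suc k"] by (simp add: mod_Suc_eq)
    then show ?thesis
      using assms[of "k mod m"] m_ge_3 by (simp add: V_mod)
  qed
  then show ?thesis by (simp add: mem_Q_iff)
qed

lemma card_coordinates: "CARD('v + 'e) = 2 * m"
  using bij_betw_same_card[OF bij_V] bij_betw_same_card[OF bij_E] by (simp add: card_UNIV_sum)

lemma sum_coordinates: "(\<Sum>k\<in>UNIV. f k) = (\<Sum>i<m. f (Inl (V i))) + (\<Sum>i<m. f (Inr (E i)))"
  for f :: "'v + 'e \<Rightarrow> real"
proof -
  have "(\<Sum>k\<in>UNIV. f k) = (\<Sum>u\<in>UNIV. f (Inl u)) + (\<Sum>e\<in>UNIV. f (Inr e))"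
    by (simp add: UNIV_Plus_UNIV[symmetric] sum.Plus del: UNIV_Plus_UNIV)
  also have "(\<Sum>u\<in>UNIV. f (Inl u)) = (\<Sum>i<m. f (Inl (V i)))"
    using bij_V by (rule sum.reindex_bij_betw[symmetric])
  also have "(\<Sum>e\<in>UNIV. f (Inr e)) = (\<Sum>i<m. f (Inr (E i)))"
    using bij_E by (rule sum.reindex_bij_betw[symmetric])
  finally show ?thesis .
qed

lemma all_coordinates: "(\<forall>k. \<phi> k) \<longleftrightarrow> (\<forall>i<m. \<phi> (Inl (V i)) \<and> \<phi> (Inr (E i)))"
  by (metis E_cases V_cases sumE)

section \<open>The simplices cut off by the cycle inequalities\<close>

definition vi :: "'v \<Rightarrow> nat" where "vi = inv_into {..<m} V"
definition ei :: "'e \<Rightarrow> nat" where "ei = inv_into {..<m} E"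

lemma vi [simp]: "i < m \<Longrightarrow> vi (V i) = i" and ei [simp]: "i < m \<Longrightarrow> ei (E i) = i"
  using bij_V bij_E by (auto simp: vi_def ei_def bij_betw_inv_into_left)

section \<open>Measurability and boundedness of the polytopes\<close>

lemma Q_borel [measurable]: "Q \<in> sets borel"
proof -
  have "Q = {p. \<forall>k\<in>{..<m}. edge_constraints (x p k) (x p (Suc k)) (y p k)}"
    using Q_I Q_edge by auto
  then show ?thesis
    unfolding edge_constraints_def by (simp only:) measurable
qed

lemma bounded_Q: "bounded Q"
proof -
  have "Q \<subseteq> cbox 0 (\<chi> i. 1)"
    by (auto simp: mem_box_cart Q_polytope_def)
  then show ?thesis
    by (rule bounded_subset[OF bounded_cbox])
qed

lemma emeasure_subset_Q_finite: "A \<subseteq> Q \<Longrightarrow> emeasure lborel A \<noteq> \<infinity>"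
  using emeasure_bounded_finite[OF bounded_subset[OF bounded_Q]] by (metis less_irrefl)

lemma P_borel [measurable]: "P \<in> sets borel"
proof -
  have "finite {p :: real ^ ('v + 'e). \<forall>k. p $ k = 0 \<or> p $ k = 1}"
    (is "finite ?B")
  proof -
    have "?B \<subseteq> vec_lambda ` (UNIV \<rightarrow>\<^sub>E {0, 1})"
    proof
      fix p assume "p \<in> ?B"
      then have "p = vec_lambda (vec_nth p)" "vec_nth p \<in> UNIV \<rightarrow>\<^sub>E {0, 1}"
        by (auto simp: PiE_def)
      then show "p \<in> vec_lambda ` (UNIV \<rightarrow>\<^sub>E {0, 1})" by blast
    qed
    then show ?thesis
      by (rule finite_subset) (simp add: finite_PiE)
  qed
  then have "compact P"
    unfolding P_polytope_def by (intro finite_imp_compact_convex_hull finite_subset[OF _ \<open>finite ?B\<close>]) auto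
  then show ?thesis
    by (simp add: compact_imp_closed)
qed

text \<open>Only the upper bounds on \<open>y\<close> enter, because the other edge inequalities are
  still to be derived where this is applied to points of \<open>T\<close>.\<close>

lemma dist_le_sum_d:
  assumes "\<And>i. j \<le> i \<Longrightarrow> i < k \<Longrightarrow> y p i \<le> x p i \<and> y p i \<le> x p (Suc i)" "j \<le> k"
  shows "\<bar>x p j - x p k\<bar> \<le> (\<Sum>i\<in>{j..<k}. d p i)"
  using assms(2,1)
proof (induction k rule: dec_induct)
  case (step k)
  have triangle: "\<bar>a - c\<bar> \<le> s + (b + c - 2 * e)" if "\<bar>a - b\<bar> \<le> s" "e \<le> b" "e \<le> c" for a b c e s :: real
    using that by linarith
  have "\<bar>x p j - x p (Suc k)\<bar> \<le> (\<Sum>i\<in>{j..<k}. d p i) + d p k"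
    by (rule triangle) (use step in auto)
  also have "\<dots> = (\<Sum>i\<in>{j..<Suc k}. d p i)"
    using step(1) by simp
  finally show ?case .
qed simp

text \<open>\<open>T\<close> is a simplex: adding up the slacks of those inequalities that are tight at the edges
  \<open>0, \<dots>, m - 2\<close> for \<open>d = 0\<close> and at the edge \<open>m - 1\<close> for \<open>d = 1\<close> gives
  \<open>d\<^sub>0 + \<dots> + d\<^sub>m\<^sub>-\<^sub>2 + 1 - d\<^sub>m\<^sub>-\<^sub>1\<close>, and the remaining edge inequalities follow.\<close>

lemma mem_T_iff: "p \<in> T \<longleftrightarrow>
    (\<forall>i<m - 1. y p i \<le> x p i \<and> y p i \<le> x p (Suc i)) \<and>
    0 \<le> y p (m - 1) \<and> x p (m - 1) + x p 0 \<le> 1 + y p (m - 1) \<and>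
    (\<Sum>i<m - 1. d p i) < d p (m - 1)"
    (is "_ \<longleftrightarrow> ?R")
proof
  assume "p \<in> T"
  then have p: "p \<in> Q" and sum: "(\<Sum>i<m - 1. d p i) < d p (m - 1)" by (auto simp: T_def)
  have "y p i \<le> x p i \<and> y p i \<le> x p (Suc i)" for i
    using Q_edge[OF p, of i] by (simp add: edge_constraints_def)
  moreover have "0 \<le> y p (m - 1) \<and> x p (m - 1) + x p 0 \<le> 1 + y p (m - 1)"
    using Q_edge[OF p, of "m - 1"] m_ge_3 by (simp add: edge_constraints_def)
  ultimately show ?R
    using sum by blast
next
  let ?n = "m - 1"
  have n: "Suc ?n = m" using m_ge_3 by simp
  assume R: ?R
  then have y: "y p i \<le> x p i" "y p i \<le> x p (Suc i)" if "i < ?n" for i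
    using that by auto
  have y_n: "0 \<le> y p ?n" "x p ?n + x p 0 \<le> 1 + y p ?n" and "(\<Sum>i<?n. d p i) < d p ?n"
    using R by auto
  then have sum: "(\<Sum>i<?n. d p i) < x p ?n + x p 0 - 2 * y p ?n"
    unfolding n V_m by simp
  have "edge_constraints (x p k) (x p (Suc k)) (y p k)" if "k < m" for k
  proof (cases "k = ?n")
    case True
    \<comment> \<open>Combined with the strict cycle violation, this makes \<open>d\<close> at the
      closing edge exceed the distance of its end points, which is equivalent to both upper bounds
      on \<open>y\<close>.\<close>
    have "\<bar>x p 0 - x p ?n\<bar> \<le> (\<Sum>i<?n. d p i)"
      using dist_le_sum_d[of 0 ?n p] y by (simp add: atLeast0LessThan)
    with sum have "y p ?n \<le> x p ?n" "y p ?n \<le> x p 0"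
      by linarith+
    then have "edge_constraints (x p ?n) (x p 0) (y p ?n)"
      using y_n by (simp add: edge_constraints_def)
    then show ?thesis
      unfolding True n V_m .
  next
    case False
    with that have k: "k < ?n" by simp
    have "\<bar>x p 0 - x p k\<bar> \<le> (\<Sum>i\<in>{0..<k}. d p i)"
      using k y by (intro dist_le_sum_d) auto
    moreover have "\<bar>x p (Suc k) - x p ?n\<bar> \<le> (\<Sum>i\<in>{Suc k..<?n}. d p i)"
      using k y by (intro dist_le_sum_d) auto
    moreover have "(\<Sum>i<?n. d p i) = (\<Sum>i\<in>{0..<k}. d p i) + d p k + (\<Sum>i\<in>{Suc k..<?n}. d p i)"
    proof -
      have "(\<Sum>i<?n. d p i) = (\<Sum>i\<in>{0..<k}. d p i) + (\<Sum>i\<in>{k..<?n}. d p i)"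
        using k by (simp add: lessThan_atLeast0 sum.atLeastLessThan_concat)
      also have "(\<Sum>i\<in>{k..<?n}. d p i) = d p k + (\<Sum>i\<in>{Suc k..<?n}. d p i)"
        using k by (rule sum.atLeast_Suc_lessThan)
      finally show ?thesis by simp
    qed
    ultimately have *: "\<bar>x p 0 - x p k\<bar> + \<bar>x p (Suc k) - x p ?n\<bar> + d p k < x p ?n + x p 0 - 2 * y p ?n"
      using sum by linarith
    \<comment> \<open>Bounding the absolute values from below with one sign gives
      \<open>y p ?n < y p k\<close>; with the other sign, \<open>x p k + x p (Suc k) - y p k\<close>
      is less than the same expression at the closing edge, hence less than 1.\<close>
    have "0 \<le> y p k"
      using * y_n by linarith
    moreover have "x p k + x p (Suc k) \<le> 1 + y p k"
      using * y_n by linarith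
    ultimately show ?thesis
      using y[OF k] by (simp add: edge_constraints_def)
  qed
  then have "p \<in> Q" by (rule Q_I)
  then show "p \<in> T"
    using R by (simp add: T_def)
qed

text \<open>The passage to the slacks is split into two triangular maps. This one follows the order
  \<open>x 0, y 0, x 1, y 1, ...\<close>, replacing \<open>y i\<close> by \<open>x i - y i\<close>
  and \<open>x (Suc i)\<close> by \<open>x (Suc i) - y i\<close>; it keeps \<open>x 0\<close> and
  the last \<open>y\<close>.\<close>

definition slack1 :: "real ^ ('v + 'e) \<Rightarrow> real ^ ('v + 'e)" where
  "slack1 p = (\<chi> k. case k of
     Inl u \<Rightarrow> if u = V 0 then p $ k else p $ k - y p (vi u - 1)
   | Inr e \<Rightarrow> if e = E (m - 1) then p $ k else x p (ei e) - p $ k)"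

text \<open>The last slack \<open>1 - x (m - 1) - x 0 + y (m - 1)\<close> replaces
  \<open>x 0\<close>. In terms of the other slacks, \<open>x (m - 1) - x 0\<close> is a telescoping
  sum, which leaves the coefficient -2 at \<open>x 0\<close>, the source of the determinant.\<close>

definition slack2 :: "real ^ ('v + 'e) \<Rightarrow> real ^ ('v + 'e)" where
  "slack2 w = (\<chi> k. if k = Inl (V 0)
     then 1 - 2 * w $ k - (\<Sum>i<m - 1. x w (Suc i) - y w i) + y w (m - 1) else w $ k)"

lemma slack1:
  "x (slack1 p) 0 = x p 0" "y (slack1 p) (m - 1) = y p (m - 1)"
  "i < m - 1 \<Longrightarrow> x (slack1 p) (Suc i) = x p (Suc i) - y p i"
  "i < m - 1 \<Longrightarrow> y (slack1 p) i = x p i - y p i"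
  using m_ge_3 by (auto simp: slack1_def V_eq_iff E_eq_iff)

lemma slack:
  "x (slack2 (slack1 p)) 0 = 1 - x p (m - 1) - x p 0 + y p (m - 1)"
  "y (slack2 (slack1 p)) (m - 1) = y p (m - 1)"
  "i < m - 1 \<Longrightarrow> x (slack2 (slack1 p)) (Suc i) = x p (Suc i) - y p i"
  "i < m - 1 \<Longrightarrow> y (slack2 (slack1 p)) i = x p i - y p i"
proof -
  have "(\<Sum>i<m - 1. x (slack1 p) (Suc i) - y (slack1 p) i) = (\<Sum>i<m - 1. x p (Suc i) - x p i)"
    by (intro sum.cong refl) (simp add: slack1 del: One_nat_def)
  also have "\<dots> = x p (m - 1) - x p 0"
    by (rule sum_lessThan_telescope)
  finally show "x (slack2 (slack1 p)) 0 = 1 - x p (m - 1) - x p 0 + y p (m - 1)"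
    by (simp add: slack2_def slack1 del: One_nat_def)
  show "y (slack2 (slack1 p)) (m - 1) = y p (m - 1)"
    by (simp add: slack2_def slack1 del: One_nat_def)
  show "i < m - 1 \<Longrightarrow> x (slack2 (slack1 p)) (Suc i) = x p (Suc i) - y p i"
    using slack1(3)[of i p] by (simp add: slack2_def V_eq_iff)
  show "i < m - 1 \<Longrightarrow> y (slack2 (slack1 p)) i = x p i - y p i"
    using slack1(4)[of i p] by (simp add: slack2_def)
qed

lemma T_eq_vimage: "T = slack1 -` (slack2 -` {w. (\<forall>k. 0 \<le> w $ k) \<and> (\<Sum>k\<in>UNIV. w $ k) < 1})"
proof (rule set_eqI)
  fix p
  let ?w = "slack2 (slack1 p)" and ?n = "m - 1"
  have n: "m = Suc ?n" using m_ge_3 by simp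
  have "(\<forall>k. 0 \<le> ?w $ k) \<longleftrightarrow> 0 \<le> x ?w 0 \<and> 0 \<le> y ?w ?n \<and> (\<forall>i<?n. 0 \<le> x ?w (Suc i) \<and> 0 \<le> y ?w i)"
    (is "_ \<longleftrightarrow> ?N")
  proof
    assume ?N
    have "0 \<le> x ?w i" if "i < m" for i
      using \<open>?N\<close> that by (cases i) auto
    moreover have "0 \<le> y ?w i" if "i < m" for i
      using \<open>?N\<close> that by (cases "i = ?n") auto
    ultimately show "\<forall>k. 0 \<le> ?w $ k"
      by (simp add: all_coordinates)
  qed blast
  also have "\<dots> \<longleftrightarrow> (\<forall>i<?n. y p i \<le> x p i \<and> y p i \<le> x p (Suc i)) \<and> 0 \<le> y p ?n \<and> x p ?n + x p 0 \<le> 1 + y p ?n"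
    by (auto simp: slack simp del: One_nat_def)
  finally have nonneg: "(\<forall>k. 0 \<le> ?w $ k) \<longleftrightarrow> (\<forall>i<?n. y p i \<le> x p i \<and> y p i \<le> x p (Suc i)) \<and> 0 \<le> y p ?n \<and> x p ?n + x p 0 \<le> 1 + y p ?n" .
  have "(\<Sum>k\<in>UNIV. ?w $ k) = (\<Sum>i<Suc ?n. x ?w i) + (\<Sum>i<Suc ?n. y ?w i)"
    unfolding sum_coordinates n[symmetric] ..
  also have "\<dots> = x ?w 0 + y ?w ?n + (\<Sum>i<?n. x ?w (Suc i) + y ?w i)"
    unfolding sum.lessThan_Suc_shift[of "x ?w"] by (simp add: sum.distrib del: One_nat_def)
  also have "(\<Sum>i<?n. x ?w (Suc i) + y ?w i) = (\<Sum>i<?n. d p i)"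
    by (intro sum.cong refl) (simp add: slack del: One_nat_def)
  also have "x ?w 0 + y ?w ?n = 1 - d p ?n"
    using n by (simp add: slack del: One_nat_def)
  finally have "(\<Sum>k\<in>UNIV. ?w $ k) < 1 \<longleftrightarrow> (\<Sum>i<?n. d p i) < d p ?n"
    by auto
  with nonneg show "p \<in> T \<longleftrightarrow> p \<in> slack1 -` (slack2 -` {w. (\<forall>k. 0 \<le> w $ k) \<and> (\<Sum>k\<in>UNIV. w $ k) < 1})"
    unfolding mem_T_iff by auto
qed

lemma measure_slack1_vimage:
  assumes S: "S \<in> sets borel"
  shows "slack1 -` S \<in> sets borel" "measure lborel (slack1 -` S) = measure lborel S"
proof -
  define c :: "'v + 'e \<Rightarrow> real" where "c k = (case k of Inl u \<Rightarrow> 1 | Inr e \<Rightarrow> if e = E (m - 1) then 1 else -1)" for k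
  define g where "g k p = (case k of Inl u \<Rightarrow> if u = V 0 then 0 else - y p (vi u - 1)
    | Inr e \<Rightarrow> if e = E (m - 1) then 0 else x p (ei e))" for k :: "'v + 'e" and p :: "real ^ ('v + 'e)"
  \<comment> \<open>Vertices get even ranks and edges odd ones, interleaved along the path.\<close>
  define r where "r k = (case k of Inl u \<Rightarrow> 2 * vi u | Inr e \<Rightarrow> 2 * ei e + 1)" for k :: "'v + 'e"
  have f: "slack1 p $ k = c k * p $ k + g k p" for p k
    by (auto simp: slack1_def c_def g_def split: sum.split)
  have c: "c k \<noteq> 0" for k
    by (auto simp: c_def split: sum.split)
  have g: "g k \<in> borel_measurable borel" for k
    unfolding g_def by (cases k) auto
  have dep: "g k p = g k q" if *: "\<And>j. r j < r k \<Longrightarrow> p $ j = q $ j" for k p q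
  proof (cases k)
    case (Inl u)
    obtain i where i: "i < m" "u = V i" by (rule V_cases)
    show ?thesis
    proof (cases i)
      case (Suc j)
      then have "r (Inr (E j)) < r k"
        using i Inl by (simp add: r_def)
      from *[OF this] show ?thesis
        using i Inl Suc by (simp add: g_def)
    qed (use i Inl in \<open>simp add: g_def\<close>)
  next
    case (Inr e)
    obtain i where i: "i < m" "e = E i" by (rule E_cases)
    then have "r (Inl (V i)) < r k"
      using Inr by (simp add: r_def)
    from *[OF this] show ?thesis
      using i Inr by (simp add: g_def)
  qed
  have "(\<Prod>k\<in>UNIV. \<bar>c k\<bar>) = 1"
    by (rule prod.neutral) (auto simp: c_def split: sum.split)
  then show "measure lborel (slack1 -` S) = measure lborel S"
    using measure_triangular_vimage[of slack1 c g r S, OF f c g dep S] by simp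
  show "slack1 -` S \<in> sets borel"
    by (rule emeasure_triangular_vimage(1)[of slack1 c g r S, OF f c g dep S])
qed

lemma measure_slack2_vimage:
  assumes S: "S \<in> sets borel"
  shows "slack2 -` S \<in> sets borel" "measure lborel (slack2 -` S) = measure lborel S / 2"
proof -
  define c :: "'v + 'e \<Rightarrow> real" where "c k = (if k = Inl (V 0) then -2 else 1)" for k
  define g where "g k w = (if k = Inl (V 0) then 1 - (\<Sum>i<m - 1. x w (Suc i) - y w i) + y w (m - 1) else 0)"
    for k :: "'v + 'e" and w :: "real ^ ('v + 'e)"
  \<comment> \<open>Only \<open>x 0\<close> is changed, with the help of all other kinds of
    coordinates, so it is ranked last.\<close>
  define r :: "'v + 'e \<Rightarrow> nat" where "r k = (if k = Inl (V 0) then 1 else 0)" for k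
  have f: "slack2 p $ k = c k * p $ k + g k p" for p k
    by (simp add: slack2_def c_def g_def)
  have c: "c k \<noteq> 0" for k
    by (simp add: c_def)
  have g: "g k \<in> borel_measurable borel" for k
    unfolding g_def by simp
  have dep: "g k p = g k q" if *: "\<And>j. r j < r k \<Longrightarrow> p $ j = q $ j" for k p q
  proof (cases "k = Inl (V 0)")
    case True
    then have **: "p $ j = q $ j" if "j \<noteq> Inl (V 0)" for j
      using that by (intro *) (simp add: r_def)
    have "x p (Suc i) = x q (Suc i)" if "i < m - 1" for i
      using that by (intro **) (simp add: V_eq_iff)
    then have "(\<Sum>i<m - 1. x p (Suc i) - y p i) = (\<Sum>i<m - 1. x q (Suc i) - y q i)"
      by (intro sum.cong refl) (simp add: **)
    then show ?thesis
      by (simp add: g_def **)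
  qed (simp add: g_def)
  have "(\<Prod>k\<in>UNIV. \<bar>c k\<bar>) = (\<Prod>k\<in>(UNIV :: ('v + 'e) set). if k = Inl (V 0) then 2 else (1 :: real))"
    by (intro prod.cong) (auto simp: c_def)
  also have "\<dots> = 2" by simp
  finally show "measure lborel (slack2 -` S) = measure lborel S / 2"
    using measure_triangular_vimage[of slack2 c g r S, OF f c g dep S] by simp
  show "slack2 -` S \<in> sets borel"
    by (rule emeasure_triangular_vimage(1)[of slack2 c g r S, OF f c g dep S])
qed

lemma T_borel [measurable]: "T \<in> sets borel"
  and measure_T: "measure lborel T = 1 / (2 * fact (2 * m))"
proof -
  have S: "{w :: real ^ ('v + 'e). (\<forall>k. 0 \<le> w $ k) \<and> (\<Sum>k\<in>UNIV. w $ k) < 1} \<in> sets borel"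
    by measurable
  note S2 = measure_slack2_vimage[OF S]
  show "T \<in> sets borel"
    unfolding T_eq_vimage by (rule measure_slack1_vimage(1)[OF S2(1)])
  show "measure lborel T = 1 / (2 * fact (2 * m))"
    unfolding T_eq_vimage measure_slack1_vimage(2)[OF S2(1)] S2(2) measure_std_simplex(2) card_coordinates
    by simp
qed

text \<open>The switching sets avoiding \<open>V 0\<close> represent all sets up to complement,
  which gives \<open>2 ^ (m - 1)\<close> disjoint pieces, all with the volume of
  \<open>T\<close>.\<close>

lemma measure_Q_eq_P: "measure lborel Q = measure lborel P + 2 ^ (m - 1) / (2 * fact (2 * m))"
proof -
  let ?Rs = "Pow (- {V 0})" and ?T = "\<lambda>R. switch ends R -` T"
  have T_sub: "?T R \<subseteq> Q" for R
    by (auto simp: T_def)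
  have T_sets: "?T R \<in> sets borel" for R
    by (rule measure_switch_vimage) measurable
  have disj: "disjoint_family_on ?T ?Rs"
    unfolding disjoint_family_on_def using switch_T_disjoint by blast
  have "Q = P \<union> (\<Union>R\<in>?Rs. ?T R)"
  proof (intro equalityI subsetI)
    fix p assume "p \<in> Q"
    then show "p \<in> P \<union> (\<Union>R\<in>?Rs. ?T R)"
      using Q_subset_P_un_T[of p] by auto
  qed (use P_subset T_sub in blast)
  then have "measure lborel Q = measure lborel (P \<union> (\<Union>R\<in>?Rs. ?T R))"
    by simp
  also have "\<dots> = measure lborel P + measure lborel (\<Union>R\<in>?Rs. ?T R)"
  proof (rule measure_Union)
    show "(\<Union>R\<in>?Rs. ?T R) \<in> sets lborel"
      unfolding sets_lborel using T_sets by (intro sets.finite_UN) auto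
    show "emeasure lborel P \<noteq> \<infinity>" "emeasure lborel (\<Union>R\<in>?Rs. ?T R) \<noteq> \<infinity>"
      using P_subset T_sub by (intro emeasure_subset_Q_finite; blast)+
    show "P \<inter> (\<Union>R\<in>?Rs. ?T R) = {}"
      using P_subset by blast
  qed simp
  also have "measure lborel (\<Union>R\<in>?Rs. ?T R) = (\<Sum>R\<in>?Rs. measure lborel (?T R))"
    using T_sub T_sets disj by (intro measure_finite_Union emeasure_subset_Q_finite) auto
  also have "\<dots> = (\<Sum>R\<in>?Rs. 1 / (2 * fact (2 * m)))"
    by (intro sum.cong refl) (simp add: measure_switch_vimage measure_T)
  also have "\<dots> = 2 ^ (m - 1) / (2 * fact (2 * m))"
    using bij_betw_same_card[OF bij_V] by (simp add: card_Pow Compl_eq_Diff_UNIV card_Diff_singleton)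
  finally show ?thesis .
qed

section \<open>Labellings of the zigzag cycle\<close>

text \<open>The closed walk \<open>V 0, E 0, V 1, E 1, ...\<close> of length \<open>2 * m\<close> on
  which the zigzag poset lives.\<close>

definition c :: "nat \<Rightarrow> 'v + 'e" where
  "c i = (if even i then Inl (V (i div 2)) else Inr (E (i div 2)))"

lemma c_period: "c (i + 2 * m) = c i"
  using V_period[of "i div 2"] E_period[of "i div 2"] by (simp add: c_def add.commute)

lemma c_mod: "c (i mod (2 * m)) = c i"
proof -
  have "c (j + n * (2 * m)) = c j" for j n
    by (induction n) (simp_all add: add.commute[of "2 * m"] add.assoc[symmetric] c_period)
  from this[of "i mod (2 * m)" "i div (2 * m)"] show ?thesis
    by (simp only: mod_div_mult_eq)
qed

lemma mod_shift: "\<exists>i<2 * m. (i + 2 * k) mod (2 * m) = j mod (2 * m)"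
proof (intro exI conjI)
  \<comment> \<open>The multiple \<open>2 * k * (2 * m - 1)\<close> is \<open>-2 * k\<close> modulo
    \<open>2 * m\<close> without subtraction from \<open>j\<close>.\<close>
  let ?i = "(j + 2 * k * (2 * m - 1)) mod (2 * m)"
  show "?i < 2 * m" using m_ge_3 by simp
  have "(?i + 2 * k) mod (2 * m) = (j + 2 * k * (2 * m - 1) + 2 * k) mod (2 * m)"
    by (rule mod_add_left_eq)
  also have "j + 2 * k * (2 * m - 1) + 2 * k = j + 2 * k * (2 * m)"
    using m_ge_3 by (cases m) (simp_all add: algebra_simps)
  also have "(j + 2 * k * (2 * m)) mod (2 * m) = j mod (2 * m)"
    by (rule mod_mult_self1)
  finally show "(?i + 2 * k) mod (2 * m) = j mod (2 * m)" .
qed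

lemma bij_c: "bij_betw (\<lambda>i. c (i + 2 * k)) {..<2 * m} UNIV"
proof -
  have "u \<in> (\<lambda>i. c (i + 2 * k)) ` {..<2 * m}" for u
  proof -
    have "\<exists>j. u = c j"
    proof (cases u)
      case (Inl w)
      obtain i where "w = V i" by (rule V_cases)
      then show ?thesis using Inl by (intro exI[of _ "2 * i"]) (simp add: c_def)
    next
      case (Inr w)
      obtain i where "w = E i" by (rule E_cases)
      then show ?thesis using Inr by (intro exI[of _ "2 * i + 1"]) (simp add: c_def)
    qed
    then obtain j where j: "u = c j" ..
    obtain i where "i < 2 * m" "(i + 2 * k) mod (2 * m) = j mod (2 * m)"
      using mod_shift by blast
    then have "c (i + 2 * k) = u"
      using c_mod[of "i + 2 * k"] c_mod[of j] j by simp
    then show ?thesis using \<open>i < 2 * m\<close> by blast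
  qed
  then have image: "(\<lambda>i. c (i + 2 * k)) ` {..<2 * m} = UNIV"
    by blast
  have "inj_on (\<lambda>i. c (i + 2 * k)) {..<2 * m}"
    by (intro eq_card_imp_inj_on) (use card_coordinates in \<open>simp_all add: image\<close>)
  with image show ?thesis
    by (simp add: bij_betw_def)
qed

text \<open>The linear extensions of the zigzag poset, in which every edge lies below its two end
  points; labels start at 0.\<close>

definition labelling :: "('v + 'e \<Rightarrow> nat) \<Rightarrow> bool" where
  "labelling f \<longleftrightarrow> bij_betw f UNIV {..<2 * m} \<and>
     (\<forall>k. f (Inr (E k)) < f (Inl (V k)) \<and> f (Inr (E k)) < f (Inl (V (Suc k))))"

text \<open>A shift by \<open>2 * k\<close> preserves parities, so the comparisons may be read off
  along the walk from any vertex \<open>V k\<close>, in particular from the one at which the cycle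
  is to be cut.\<close>

lemma labelling_iff:
  "labelling f \<longleftrightarrow> bij_betw f UNIV {..<2 * m} \<and>
     (\<forall>i<2 * m. if odd i then f (c (i + 2 * k)) < f (c (Suc i + 2 * k)) else f (c (Suc i + 2 * k)) < f (c (i + 2 * k)))"
proof -
  define A where "A i \<longleftrightarrow> (if odd i then f (c i) < f (c (Suc i)) else f (c (Suc i)) < f (c i))" for i
  have A_mod: "A (i mod (2 * m)) = A i" for i
  proof -
    have "c (Suc (i mod (2 * m))) = c (Suc (i mod (2 * m)) mod (2 * m))"
      by (rule c_mod[symmetric])
    also have "\<dots> = c (Suc i)"
      unfolding mod_Suc_eq by (rule c_mod)
    finally have "c (Suc (i mod (2 * m))) = c (Suc i)" .
    moreover have "odd (i mod (2 * m)) \<longleftrightarrow> odd i"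
      by (simp add: dvd_mod_iff)
    ultimately show ?thesis
      by (simp add: A_def c_mod)
  qed
  have "(\<forall>k. f (Inr (E k)) < f (Inl (V k)) \<and> f (Inr (E k)) < f (Inl (V (Suc k)))) \<longleftrightarrow> (\<forall>i. A i)"
  proof (intro iffI allI)
    fix i assume *: "\<forall>k. f (Inr (E k)) < f (Inl (V k)) \<and> f (Inr (E k)) < f (Inl (V (Suc k)))"
    show "A i"
      using *[rule_format, of "i div 2"] by (cases "even i") (auto simp: A_def c_def elim!: evenE oddE)
  next
    fix k assume "\<forall>i. A i"
    then have "A (2 * k)" "A (2 * k + 1)" by blast+
    then show "f (Inr (E k)) < f (Inl (V k)) \<and> f (Inr (E k)) < f (Inl (V (Suc k)))"
      by (simp add: A_def c_def)
  qed
  also have "\<dots> \<longleftrightarrow> (\<forall>i<2 * m. A (i + 2 * k))"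
  proof (intro iffI allI)
    fix j assume *: "\<forall>i<2 * m. A (i + 2 * k)"
    obtain i where "i < 2 * m" "(i + 2 * k) mod (2 * m) = j mod (2 * m)"
      using mod_shift by blast
    with * show "A j"
      using A_mod[of "i + 2 * k"] A_mod[of j] by metis
  qed simp
  finally show ?thesis
    unfolding labelling_def A_def by simp
qed

text \<open>Read from \<open>V k\<close>, the positions \<open>1, ..., 2 * m - 1\<close> start with
  an edge, which has a small label. Complementing the labels turns this into the initial descent of
  an alternating permutation, and sends the top label at position 0 to the fixed point 0.\<close>

lemma card_labellings_top:
  "card {f. labelling f \<and> f (Inl (V k)) = 2 * m - 1} = euler_number (2 * m - 1)"
proof -
  let ?M = "2 * m - 1"
  let ?c = "\<lambda>i. c (i + 2 * k)"
  let ?inv = "inv_into {..<2 * m} ?c"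
  let ?L = "{f. labelling f \<and> f (Inl (V k)) = ?M}"
  let ?W = "{w. w permutes {1..?M} \<and> (\<forall>i\<in>{1..<?M}. if odd i then w i > w (i + 1) else w i < w (i + 1))}"
  \<comment> \<open>The values beyond the walk are those demanded of a function that
    \<open>permutes {1..?M}\<close>.\<close>
  define \<Phi> where "\<Phi> f i = (if i < 2 * m then ?M - f (?c i) else i)" for f i
  define \<Psi> where "\<Psi> w u = ?M - w (?inv u)" for w u
  have M: "0 < ?M" "Suc ?M = 2 * m"
    using m_ge_3 by auto
  have c0: "?c 0 = Inl (V k)"
    by (simp add: c_def)
  have inv: "?inv u < 2 * m" "?c (?inv u) = u" for u
    using bij_betw_inv_into[OF bij_c, of k] bij_betw_inv_into_right[OF bij_c, of u k]
    by (auto simp: bij_betw_def)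
  have inv_c: "?inv (?c i) = i" if "i < 2 * m" for i
    using that by (intro bij_betw_inv_into_left[OF bij_c]) simp
  have c_inj: "i = j" if "?c i = ?c j" "i < 2 * m" "j < 2 * m" for i j
    using inj_onD[OF bij_betw_imp_inj_on[OF bij_c[of k]], of i j] that by blast
  have L_less: "f u < 2 * m" and L_inj: "f u = f v \<longleftrightarrow> u = v" if "f \<in> ?L" for f u v
    using that by (auto simp: labelling_def bij_betw_def inj_def)
  have "bij_betw \<Phi> ?L ?W"
  proof (rule bij_betw_byWitness[where f' = \<Psi>])
    show "\<forall>f\<in>?L. \<Psi> (\<Phi> f) = f"
    proof (intro ballI ext)
      fix f u assume "f \<in> ?L"
      then have "f u \<le> ?M" using L_less[of f u] by simp
      then show "\<Psi> (\<Phi> f) u = f u"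
        using inv[of u] by (simp add: \<Psi>_def \<Phi>_def)
    qed
    have W_le: "w i \<le> ?M" if "w \<in> ?W" "i < 2 * m" for w i
    proof -
      have "w permutes {1..?M}" using that by simp
      then show ?thesis
        using permutes_in_image[of w "{1..?M}" i] permutes_not_in[of w "{1..?M}" i] that(2)
        by (cases "i \<in> {1..?M}") auto
    qed
    show "\<forall>w\<in>?W. \<Phi> (\<Psi> w) = w"
    proof (intro ballI ext)
      fix w i assume w: "w \<in> ?W"
      show "\<Phi> (\<Psi> w) i = w i"
      proof (cases "i < 2 * m")
        case True
        then show ?thesis
          using W_le[OF w True] by (simp add: \<Psi>_def \<Phi>_def inv_c)
      next
        case False
        then have "w i = i"
          using w by (intro permutes_not_in[of w "{1..?M}"]) auto
        with False show ?thesis by (simp add: \<Phi>_def)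
      qed
    qed
    show "\<Phi> ` ?L \<subseteq> ?W"
    proof (intro image_subsetI CollectI conjI)
      fix f assume f: "f \<in> ?L"
      have inj: "inj_on (\<Phi> f) {1..?M}"
      proof (rule inj_onI)
        fix i j assume ij: "i \<in> {1..?M}" "j \<in> {1..?M}" "\<Phi> f i = \<Phi> f j"
        then have "i < 2 * m" "j < 2 * m" by auto
        with ij(3) have "?M - f (?c i) = ?M - f (?c j)"
          by (simp only: \<Phi>_def if_True)
        moreover have "f (?c i) \<le> ?M" "f (?c j) \<le> ?M"
          using L_less[OF f, of "?c i"] L_less[OF f, of "?c j"] by linarith+
        ultimately have "f (?c i) = f (?c j)"
          by linarith
        then have "?c i = ?c j"
          by (rule iffD1[OF L_inj[OF f]])
        then show "i = j"
          using \<open>i < 2 * m\<close> \<open>j < 2 * m\<close> by (rule c_inj)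
      qed
      have "\<Phi> f i \<in> {1..?M}" if "i \<in> {1..?M}" for i
      proof -
        have i: "i < 2 * m" "i \<noteq> 0" using that by auto
        have "?c i \<noteq> ?c 0"
        proof
          assume "?c i = ?c 0"
          then have "i = 0"
            by (rule c_inj) (use i in auto)
          with i(2) show False ..
        qed
        then have "f (?c i) \<noteq> f (Inl (V k))"
          unfolding c0 L_inj[OF f] .
        then have "f (?c i) \<noteq> ?M" using f by simp
        then have "f (?c i) < ?M"
          using L_less[OF f, of "?c i"] by linarith
        then show ?thesis
          using i by (auto simp: \<Phi>_def)
      qed
      then have "\<Phi> f ` {1..?M} = {1..?M}"
        by (intro endo_inj_surj inj) auto
      moreover have "\<Phi> f i = i" if "i \<notin> {1..?M}" for i
      proof (cases "i = 0")
        case True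
        then show ?thesis using f c0 M by (simp add: \<Phi>_def)
      next
        case False
        then show ?thesis using that by (simp add: \<Phi>_def)
      qed
      ultimately show "\<Phi> f permutes {1..?M}"
        using inj by (intro bij_imp_permutes) (auto simp: bij_betw_def)
      show "\<forall>i\<in>{1..<?M}. if odd i then \<Phi> f i > \<Phi> f (i + 1) else \<Phi> f i < \<Phi> f (i + 1)"
      proof
        fix i assume i: "i \<in> {1..<?M}"
        then have "i < 2 * m" "Suc i < 2 * m" by auto
        moreover have "if odd i then f (?c i) < f (?c (Suc i)) else f (?c (Suc i)) < f (?c i)"
          using f \<open>i < 2 * m\<close> labelling_iff[of f k] by blast
        ultimately show "if odd i then \<Phi> f i > \<Phi> f (i + 1) else \<Phi> f i < \<Phi> f (i + 1)"
          using L_less[OF f, of "?c i"] L_less[OF f, of "?c (Suc i)"]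
          by (auto simp: \<Phi>_def split: if_splits)
      qed
    qed
    show "\<Psi> ` ?W \<subseteq> ?L"
    proof (intro image_subsetI CollectI conjI)
      fix w assume w: "w \<in> ?W"
      then have perm: "w permutes {1..?M}" by simp
      have w0: "w 0 = 0"
        using perm by (rule permutes_not_in) simp
      have w_pos: "1 \<le> w i" if "i \<in> {1..?M}" for i
        using permutes_in_image[OF perm, of i] that by simp
      have \<Psi>_c: "\<Psi> w (?c i) = ?M - w i" if "i < 2 * m" for i
        using inv_c[OF that] by (simp add: \<Psi>_def)
      show top: "\<Psi> w (Inl (V k)) = ?M"
        using \<Psi>_c[of 0] c0 w0 m_ge_3 by simp
      have "inj (\<Psi> w)"
      proof (rule injI)
        fix u v assume "\<Psi> w u = \<Psi> w v"
        then have "w (?inv u) = w (?inv v)"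
          using W_le[OF w inv(1)[of u]] W_le[OF w inv(1)[of v]] by (simp add: \<Psi>_def)
        then have "?inv u = ?inv v"
          using permutes_inj[OF perm] by (auto simp: inj_def)
        then show "u = v"
          using inv(2) by metis
      qed
      moreover have "\<Psi> w ` UNIV \<subseteq> {..<2 * m}"
        using M by (auto simp: \<Psi>_def)
      moreover have "CARD('v + 'e) = 2 * m"
        using bij_betw_same_card[OF bij_c[of k]] by simp
      ultimately have "\<Psi> w ` UNIV = {..<2 * m}"
        by (intro card_subset_eq) (simp_all add: card_image)
      with \<open>inj (\<Psi> w)\<close> have bij: "bij_betw (\<Psi> w) UNIV {..<2 * m}"
        by (simp add: bij_betw_def)
      have "if odd i then \<Psi> w (?c i) < \<Psi> w (?c (Suc i)) else \<Psi> w (?c (Suc i)) < \<Psi> w (?c i)"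
        if i: "i < 2 * m" for i
      proof -
        \<comment> \<open>The first and the second case are the two comparisons with the cut vertex,
          which hold because its label is the largest; the others come from
          \<open>w\<close>.\<close>
        consider "i = 0" | "i = ?M" | "i \<in> {1..<?M}"
          using i by fastforce
        then show ?thesis
        proof cases
          case 1
          have "1 < 2 * m" "1 \<le> w 1" "w 1 \<le> ?M"
            using m_ge_3 w_pos[of 1] W_le[OF w, of 1] by auto
          then show ?thesis
            using 1 \<Psi>_c[of 0] \<Psi>_c[of 1] w0 by simp
        next
          case 2
          have "odd ?M"
            using m_ge_3 by simp
          have "?c (Suc ?M) = Inl (V k)"
            using c_period[of "2 * k"] unfolding M(2) by (simp add: add.commute c_def)
          then have "\<Psi> w (?c (Suc ?M)) = ?M"
            by (simp only: top)
          moreover have "1 \<le> w ?M" "w ?M \<le> ?M"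
            using M w_pos[of ?M] W_le[OF w, of ?M] by auto
          moreover have "\<Psi> w (?c ?M) = ?M - w ?M"
            by (rule \<Psi>_c) (use M in linarith)
          ultimately have "\<Psi> w (?c ?M) < \<Psi> w (?c (Suc ?M))"
            using M(1) by linarith
          then show ?thesis
            unfolding 2 if_P[OF \<open>odd ?M\<close>] .
        next
          case 3
          then have "Suc i < 2 * m" by auto
          moreover have "if odd i then w i > w (i + 1) else w i < w (i + 1)"
            using w 3 by blast
          moreover have "w i \<le> ?M" "w (Suc i) \<le> ?M"
            using W_le[OF w] i \<open>Suc i < 2 * m\<close> by blast+
          ultimately show ?thesis
            using \<Psi>_c[OF i] \<Psi>_c[of "Suc i"] by (auto split: if_splits)
        qed
      qed
      with bij show "labelling (\<Psi> w)"
        using labelling_iff[of "\<Psi> w" k] by blast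
    qed
  qed
  then show ?thesis
    unfolding euler_number_def by (rule bij_betw_same_card)
qed

lemma finite_labellings: "finite {f. labelling f}"
proof (rule finite_subset)
  show "{f. labelling f} \<subseteq> UNIV \<rightarrow>\<^sub>E {..<2 * m}"
    by (auto simp: labelling_def bij_betw_def)
qed (simp add: finite_PiE)

lemma card_labellings: "card {f. labelling f} = m * euler_number (2 * m - 1)"
proof -
  let ?L = "\<lambda>k. {f. labelling f \<and> f (Inl (V k)) = 2 * m - 1}"
  have "\<exists>k<m. f (Inl (V k)) = 2 * m - 1" if f: "labelling f" for f
  proof -
    have bij: "bij_betw f UNIV {..<2 * m}" using f by (simp add: labelling_def)
    have "2 * m - 1 \<in> f ` UNIV"
      using bij m_ge_3 by (simp add: bij_betw_def)
    then obtain u where u: "f u = 2 * m - 1" by auto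
    show ?thesis
    proof (cases u)
      case (Inl w)
      then show ?thesis using u by (cases w rule: V_cases) auto
    next
      case (Inr w)
      obtain k where "w = E k" by (rule E_cases)
      \<comment> \<open>An edge lies strictly below an end point and cannot carry the top
        label.\<close>
      then have "f u < f (Inl (V k))"
        using f Inr by (simp add: labelling_def)
      moreover have "f (Inl (V k)) < 2 * m"
        using bij by (auto simp: bij_betw_def)
      ultimately show ?thesis using u by simp
    qed
  qed
  then have "{f. labelling f} = (\<Union>k\<in>{..<m}. ?L k)"
    by auto
  then have "card {f. labelling f} = card (\<Union>k\<in>{..<m}. ?L k)"
    by simp
  also have "\<dots> = (\<Sum>k\<in>{..<m}. card (?L k))"
  proof (rule card_UN_disjoint)
    show "\<forall>k\<in>{..<m}. finite (?L k)"
      using finite_labellings by (auto intro: finite_subset[rotated])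
    show "\<forall>j\<in>{..<m}. \<forall>k\<in>{..<m}. j \<noteq> k \<longrightarrow> ?L j \<inter> ?L k = {}"
    proof (intro ballI impI equals0I)
      fix j k f assume "j \<in> {..<m}" "k \<in> {..<m}" "j \<noteq> k" "f \<in> ?L j \<inter> ?L k"
      then have "f (Inl (V j)) = f (Inl (V k))" "inj f"
        by (auto simp: labelling_def bij_betw_def)
      then have "V j = V k" by (auto dest: injD)
      then show False
        using \<open>j \<in> {..<m}\<close> \<open>k \<in> {..<m}\<close> \<open>j \<noteq> k\<close> V_eq_iff by simp
    qed
  qed simp
  also have "\<dots> = m * euler_number (2 * m - 1)"
    unfolding card_labellings_top by simp
  finally show ?thesis .
qed

section \<open>The volumes\<close>

definition H :: "(real ^ ('v + 'e)) set" where
  "H = {p \<in> Q. \<forall>k. x p k < 1 / 2}"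

definition lower_covers :: "(('v + 'e) \<times> ('v + 'e)) set" where
  "lower_covers = (\<Union>k. {(Inr (E k), Inl (V k)), (Inr (E k), Inl (V (Suc k)))})"

text \<open>For \<open>x < 1/2\<close> the constraint \<open>x i + x j \<le> 1 + y\<close> holds
  automatically. Only \<open>0 \<le> y \<le> x\<close> remains, and doubling moves the bound
  \<open>1/2\<close> to 1.\<close>

lemma H_eq_vimage: "H = (\<lambda>p. 2 *\<^sub>R p) -`
    {q. (\<forall>k. 0 \<le> q $ k \<and> q $ k < 1) \<and> (\<forall>(i, j)\<in>lower_covers. q $ i \<le> q $ j)}"
proof (intro set_eqI iffI)
  fix p assume "p \<in> H"
  then have p: "p \<in> Q" and half: "x p k < 1 / 2" for k
    by (auto simp: H_def)
  have y: "0 \<le> y p k" "y p k \<le> x p k" "y p k \<le> x p (Suc k)" for k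
    using Q_edge[OF p, of k] by (auto simp: edge_constraints_def)
  have "0 \<le> x p k" "2 * x p k < 1" "2 * y p k < 1" for k
    using half[of k] y[of k] by linarith+
  then show "p \<in> (\<lambda>p. 2 *\<^sub>R p) -` {q. (\<forall>k. 0 \<le> q $ k \<and> q $ k < 1) \<and> (\<forall>(i, j)\<in>lower_covers. q $ i \<le> q $ j)}"
    using y unfolding vimage_eq mem_Collect_eq all_coordinates by (auto simp: lower_covers_def)
next
  fix p :: "real ^ ('v + 'e)"
  assume "p \<in> (\<lambda>p. 2 *\<^sub>R p) -` {q. (\<forall>k. 0 \<le> q $ k \<and> q $ k < 1) \<and> (\<forall>(i, j)\<in>lower_covers. q $ i \<le> q $ j)}"
  then have p: "0 \<le> p $ k" "2 * p $ k < 1" and cov: "(i, j) \<in> lower_covers \<Longrightarrow> p $ i \<le> p $ j" for k i j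
    by fastforce+
  have y: "y p k \<le> x p k" "y p k \<le> x p (Suc k)" for k
    by (rule cov; auto simp: lower_covers_def)+
  have "edge_constraints (x p k) (x p (Suc k)) (y p k)" for k
    using y[of k] p(1)[of "Inr (E k)"] p(2)[of "Inl (V k)"] p(2)[of "Inl (V (Suc k))"]
    by (simp add: edge_constraints_def)
  then have "p \<in> Q" by (simp add: mem_Q_iff)
  moreover have "x p k < 1 / 2" for k
    using p(2)[of "Inl (V k)"] by simp
  ultimately show "p \<in> H" by (simp add: H_def)
qed

lemma H_borel [measurable]: "H \<in> sets borel"
proof -
  have "H = {p. p \<in> Q \<and> (\<forall>k. x p k < 1 / 2)}"
    by (simp add: H_def)
  then show ?thesis
    by (simp only:) measurable
qed

text \<open>Doubling in dimension \<open>2 * m\<close> accounts for \<open>4 ^ m\<close>; the rest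
  is the order polytope volume with its linear extensions counted.\<close>

lemma measure_H: "measure lborel H = m * euler_number (2 * m - 1) / (4 ^ m * fact (2 * m))"
proof -
  let ?J = "{q :: real ^ ('v + 'e). (\<forall>k. 0 \<le> q $ k \<and> q $ k < 1) \<and> (\<forall>(i, j)\<in>lower_covers. q $ i \<le> q $ j)}"
  have J: "?J = {q. (\<forall>k. 0 \<le> q $ k \<and> q $ k < 1) \<and> (\<forall>k. y q k \<le> x q k \<and> y q k \<le> x q (Suc k))}"
    by (auto simp: lower_covers_def)
  have J_borel: "?J \<in> sets borel"
    unfolding J by measurable
  have labelling: "bij_betw f UNIV {..<CARD('v + 'e)} \<and> (\<forall>(i, j)\<in>lower_covers. f i < f j) \<longleftrightarrow> labelling f"
    for f :: "'v + 'e \<Rightarrow> nat"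
    unfolding labelling_def card_coordinates by (auto simp: lower_covers_def)
  have irrefl: "(i, i) \<notin> lower_covers" for i
    by (auto simp: lower_covers_def)
  have "measure lborel ?J = card {f. labelling f} / fact (2 * m)"
    using measure_order_polytope[OF irrefl] unfolding labelling unfolding card_coordinates .
  moreover have "measure lborel H = measure lborel ?J / 2 ^ (2 * m)"
    unfolding H_eq_vimage using measure_scale_vimage(2)[OF J_borel, of 2]
    by (simp only: card_coordinates)
  ultimately show ?thesis
    by (simp add: card_labellings power_mult)
qed

lemma measure_Q: "measure lborel Q = m * euler_number (2 * m - 1) / (2 ^ m * fact (2 * m))"
proof -
  let ?H = "\<lambda>R. switch ends R -` H"
  have H_iff: "p \<in> ?H R \<longleftrightarrow> p \<in> Q \<and> (\<forall>k. if V k \<in> R then 1 / 2 < x p k else x p k < 1 / 2)" for p R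
    by (auto simp: H_def x_switch split: if_splits)
  have H_sub: "?H R \<subseteq> Q" for R
    using H_iff by blast
  have H_sets: "?H R \<in> sets borel" for R
    by (rule measure_switch_vimage) measurable
  have UH: "(\<Union>R. ?H R) \<in> sets borel"
    using H_sets by (intro sets.finite_UN) auto
  have disj: "disjoint_family ?H"
  proof (unfold disjoint_family_on_def, intro ballI impI equals0I)
    fix R R' p assume "R \<noteq> R'" and p: "p \<in> ?H R \<inter> ?H R'"
    have "u \<in> R \<longleftrightarrow> u \<in> R'" for u
    proof -
      obtain k where "u = V k" by (rule V_cases)
      have "if V k \<in> R then 1 / 2 < x p k else x p k < 1 / 2"
        "if V k \<in> R' then 1 / 2 < x p k else x p k < 1 / 2"
        using p unfolding Int_iff H_iff by blast+
      then show ?thesis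
        unfolding \<open>u = V k\<close> by (auto split: if_splits)
    qed
    then show False using \<open>R \<noteq> R'\<close> by blast
  qed
  have cover: "Q - (\<Union>R. ?H R) \<subseteq> (\<Union>u. {p. p $ Inl u = 1 / 2})"
  proof (rule subsetI, rule ccontr)
    fix p assume p: "p \<in> Q - (\<Union>R. ?H R)" and "p \<notin> (\<Union>u. {p. p $ Inl u = 1 / 2})"
    then have ne: "x p k \<noteq> 1 / 2" for k
      by auto
    \<comment> \<open>The copy containing \<open>p\<close> is found by switching the vertices whose
      coordinate exceeds \<open>1/2\<close>.\<close>
    have "if V k \<in> {u. 1 / 2 < p $ Inl u} then 1 / 2 < x p k else x p k < 1 / 2" for k
      using ne[of k] by auto
    then have "p \<in> ?H {u. 1 / 2 < p $ Inl u}"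
      unfolding H_iff using p by blast
    then show False using p by blast
  qed
  have "Q - (\<Union>R. ?H R) \<in> null_sets lborel"
  proof (rule measure_lborel_null_subset[OF _ cover])
    have "negligible {p :: real ^ ('v + 'e). p $ Inl u = 1 / 2}" for u
      unfolding cart_eq_inner_axis
      by (rule negligible_standard_hyperplane) (simp add: axis_in_Basis_iff)
    then show "negligible (\<Union>u. {p :: real ^ ('v + 'e). p $ Inl u = 1 / 2})"
      by (intro negligible_Union finite_imageI finite) blast
  qed (use UH in measurable)
  then have "measure lborel (Q - (Q - (\<Union>R. ?H R))) = measure lborel Q"
    by (intro measure_Diff_null_set) auto
  also have "Q - (Q - (\<Union>R. ?H R)) = (\<Union>R. ?H R)"
    using H_sub by blast
  finally have "measure lborel Q = measure lborel (\<Union>R. ?H R)" ..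
  also have "\<dots> = (\<Sum>R\<in>UNIV. measure lborel (?H R))"
    using H_sets H_sub disj by (intro measure_finite_Union emeasure_subset_Q_finite) auto
  also have "\<dots> = (\<Sum>R\<in>(UNIV :: 'v set set). measure lborel H)"
    by (intro sum.cong refl measure_switch_vimage(2)) measurable
  also have "\<dots> = 2 ^ m * (m * euler_number (2 * m - 1) / (4 ^ m * fact (2 * m)))"
    using bij_betw_same_card[OF bij_V] by (simp add: measure_H card_Pow[of "UNIV :: 'v set", simplified])
  also have "\<dots> = m * euler_number (2 * m - 1) / (2 ^ m * fact (2 * m))"
  proof -
    have "(4 :: real) ^ m = 2 ^ m * 2 ^ m"
      by (simp flip: power_mult_distrib)
    then show ?thesis by simp
  qed
  finally show ?thesis .
qed

end

text \<open>The labels \<open>1, ..., m\<close> are moved to \<open>0, ..., m - 1\<close> and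
  continued periodically by reducing modulo \<open>m\<close>, so that the exceptional successor of
  \<open>m\<close> becomes an ordinary one.\<close>

lemma is_cycle_imp_cycle:
  assumes "m \<ge> 3" "is_cycle m ends"
  obtains V E where "cycle m ends V E"
proof -
  obtain v e where v: "bij_betw v {1..m} UNIV" and e: "bij_betw e {1..m} UNIV"
    and ends: "\<And>i. i \<in> {1..m} \<Longrightarrow> ends (e i) = (v i, v (if i = m then 1 else i + 1))"
    using assms(2) unfolding is_cycle_def by blast
  have Suc: "bij_betw Suc {..<m} {1..m}"
    by (rule bij_betw_byWitness[where f' = "\<lambda>i. i - 1"]) auto
  have shift: "bij_betw (\<lambda>k. g (Suc (k mod m))) {..<m} UNIV" if "bij_betw g {1..m} UNIV" for g :: "nat \<Rightarrow> 'x"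
  proof -
    have "bij_betw (g \<circ> Suc) {..<m} UNIV"
      using Suc that by (rule bij_betw_trans)
    then show ?thesis
      by (rule bij_betw_cong[THEN iffD1, rotated]) simp
  qed
  have "ends (e (Suc (k mod m))) = (v (Suc (k mod m)), v (Suc (Suc k mod m)))" for k
  proof -
    have "k mod m < m" using assms(1) by simp
    then show ?thesis
      using ends[of "Suc (k mod m)"] by (auto simp: mod_Suc)
  qed
  then have "cycle m ends (\<lambda>k. v (Suc (k mod m))) (\<lambda>k. e (Suc (k mod m)))"
    using assms(1) shift[OF v] shift[OF e] by unfold_locales auto
  then show ?thesis by (rule that)
qed

theorem theorem19:
  fixes m :: nat
    and ends :: "'e::finite \<Rightarrow> 'v::finite \<times> 'v"
  assumes "m \<ge> 3"
    and "is_cycle m ends"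
  shows "measure lebesgue (P_polytope ends)
           = measure lebesgue (Q_polytope ends) - 2 ^ (m - 1) / (2 * fact (2 * m)) \<and>
         measure lebesgue (Q_polytope ends) - 2 ^ (m - 1) / (2 * fact (2 * m))
           = real m * real (euler_number (2 * m - 1)) / (2 ^ m * fact (2 * m))
               - 2 ^ (m - 2) / fact (2 * m)"
proof -
  obtain V E where "cycle m ends V E"
    using assms by (rule is_cycle_imp_cycle)
  then interpret cycle m ends V E .
  have "measure lebesgue P = measure lborel P" "measure lebesgue Q = measure lborel Q"
    by (simp_all add: measure_completion)
  moreover have "(2 :: real) ^ (m - 1) / (2 * fact (2 * m)) = 2 ^ (m - 2) / fact (2 * m)"
  proof -
    have "m - 1 = Suc (m - 2)"
      using assms(1) by simp
    then show ?thesis by simp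
  qed
  ultimately show ?thesis
    using measure_Q_eq_P measure_Q by simp
qed

end
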